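(* Let $\rho\ge 0$ be real with $\zeta'(1/2+i\rho)\neq 0$. Then the two equations $$\sin(\rho\ln\pi)=\frac{2\,(F_I\zeta'_R+F_R\zeta'_I)\,(F_I\zeta'_I-F_R\zeta'_R)}{|\zeta'|^2\,|F|^2}$$ and $$\cos(\rho\ln\pi)=\frac{4F_IF_R\,\zeta'_I\zeta'_R+(\zeta'^{\,2}_I-\zeta'^{\,2}_R)(-F_I^2+F_R^2)}{|\zeta'|^2\,|F|^2}$$ both hold if and only if $\zeta(1/2+i\rho)=0$ or $\rho=\rho_s$.
   Context: $\zeta$ is the Riemann zeta function and $\zeta'=d\zeta/ds$ its complex derivative. Write $\zeta'_R=\mathrm{Re}\,\zeta'(1/2+i\rho)$, $\zeta'_I=\mathrm{Im}\,\zeta'(1/2+i\rho)$, $|\zeta'|^2=\zeta'^{\,2}_R+\zeta'^{\,2}_I$, and $F=\Gamma(1/4+i\rho/2)$, $F_R=\mathrm{Re}\,F$, $F_I=\mathrm{Im}\,F$. With $\psi=\Gamma'/\Gamma$ the digamma function, $\rho_s=6.2898\ldots$ is the unique $\rho>0$ such that $$2\ln(2\pi)\cosh(\pi\rho)-2\,\mathrm{Re}(\psi(1/2+i\rho))\cosh(\pi\rho)+\pi=0.$$ *)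

theory Defs
  imports "HOL-Complex_Analysis.Complex_Analysis"
begin

text \<open>
  The analytic continuation of the Dirichlet series to the plane punctured at the pole \<open>1\<close>.
  The value \<open>0\<close> at the pole is a convention; it only makes the total function unique.
\<close>
definition zeta :: "complex \<Rightarrow> complex" where
  "zeta = (THE f. f holomorphic_on (- {1}) \<and>
                  (\<forall>s. Re s > 1 \<longrightarrow> f s = (\<Sum>n. 1 / of_nat (Suc n) powr s)) \<and>
                  f 1 = 0)"

definition rho_s :: real where
  "rho_s = (THE \<rho>. \<rho> > 0 \<and>
     2 * ln (2 * pi) * cosh (pi * \<rho>)
       - 2 * Re (Digamma (1/2 + \<i> * of_real \<rho>)) * cosh (pi * \<rho>) + pi = 0)"

end

theory Submission
  imports Defs
begin

text \<open>
  On the critical line write \<open>s = 1/2 + \<i>\<rho>\<close>, \<open>Z = \<zeta>'(s)\<close>, and \<open>\<zeta>(s) = \<chi>(s) \<zeta>(1 - s)\<close> with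
  \<open>\<chi>(s) = exp (\<i>\<rho> ln \<pi>) cnj F / F\<close> by Legendre duplication. The two equations say that
  \<open>exp (\<i>\<rho> ln \<pi>) = - (F Z)\<^sup>2 / |F Z|\<^sup>2\<close>, i.e. \<open>Z + \<chi>(s) cnj Z = 0\<close>. As \<open>1 - s = cnj s\<close>,
  differentiating the functional equation turns the left-hand side into \<open>(\<chi>'/\<chi>)(s) \<zeta>(s)\<close>, and
  \<open>Re (\<chi>'/\<chi>)(s) = ln (2\<pi>) - Re \<psi>(s) + \<pi> / (2 cosh (\<pi>\<rho>))\<close> is strictly decreasing in \<open>\<rho> \<ge> 0\<close> with
  its only zero at \<open>\<rho>\<^sub>s\<close>.

  The continuation of \<open>\<zeta>\<close> and its functional equation come from the Mellin transform of
  \<open>1 / (exp x - 1) - 1 / x + 1 / 2 = (\<Sum>n\<ge>1. 2x / (x\<^sup>2 + 4\<pi>\<^sup>2n\<^sup>2))\<close>, integrated termwise for real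
  \<open>-1 < s < 0\<close> and extended by the identity theorem.
\<close>

section \<open>Mellin transforms\<close>

text \<open>Real exponents only: integrability is bundled with the value, and evaluations take place
  on real intervals before the identity theorem carries them to complex arguments.\<close>

definition has_mellin :: "(real \<Rightarrow> real) \<Rightarrow> real \<Rightarrow> real \<Rightarrow> bool" where
  "has_mellin f s I \<longleftrightarrow>
     has_bochner_integral lborel (\<lambda>x. indicator {0<..} x * (f x * x powr (s - 1))) I"

text \<open>The integral is total, with value 0 where the integrand is not integrable. The
  exponential stands for \<open>x powr (s - 1)\<close> on positive \<open>x\<close> and expands
  directly as a power series in \<open>s\<close>.\<close>

definition mellin :: "(real \<Rightarrow> real) \<Rightarrow> complex \<Rightarrow> complex" where
  "mellin f s =
     (LINT x|lborel. complex_of_real (indicator {0<..} x * f x) * exp ((s - 1) * of_real (ln x)))"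

lemma mellin_of_real:
  assumes "has_mellin f s I"
  shows "mellin f (of_real s) = of_real I"
proof -
  have "complex_of_real (indicator {0<..} x * f x) * exp ((of_real s - 1) * of_real (ln x)) =
        complex_of_real (indicator {0<..} x * (f x * x powr (s - 1)))" for x
  proof (cases "x > 0")
    case True
    have "exp ((of_real s - 1) * of_real (ln x)) = complex_of_real (x powr (s - 1))"
      using True exp_of_real[of "(s - 1) * ln x", where 'a = complex] by (simp add: powr_def)
    then show ?thesis by simp
  qed simp
  then have "mellin f (of_real s) =
      (LINT x|lborel. complex_of_real (indicator {0<..} x * (f x * x powr (s - 1))))"
    unfolding mellin_def by presburger
  also have "\<dots> = of_real I"
    using assms by (simp add: has_mellin_def has_bochner_integral_iff del: of_real_mult)
  finally show ?thesis .
qed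

lemma has_mellin_cong:
  assumes "\<And>x. x > 0 \<Longrightarrow> f x = g x"
  shows "has_mellin f s I \<longleftrightarrow> has_mellin g s I"
  unfolding has_mellin_def
  by (intro has_bochner_integral_cong) (auto simp: indicator_def assms)

lemma has_mellin_add:
  assumes "has_mellin f s I" "has_mellin g s J"
  shows "has_mellin (\<lambda>x. f x + g x) s (I + J)"
  using has_bochner_integral_add[OF assms[unfolded has_mellin_def]]
  by (simp add: has_mellin_def algebra_simps)

lemma has_mellin_cmult:
  assumes "has_mellin f s I"
  shows "has_mellin (\<lambda>x. c * f x) s (c * I)"
  using has_bochner_integral_mult_right[OF assms[unfolded has_mellin_def], of c]
  by (simp add: has_mellin_def algebra_simps)

lemma has_mellin_shift:
  "has_mellin (\<lambda>x. f x / x) s I \<longleftrightarrow> has_mellin f (s - 1) I"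
  unfolding has_mellin_def
proof (intro has_bochner_integral_cong refl)
  fix x :: real
  show "indicator {0<..} x * (f x / x * x powr (s - 1)) =
        indicator {0<..} x * (f x * x powr (s - 1 - 1))"
    using powr_mult_base[of x "s - 1 - 1"] by (auto simp: indicator_def field_simps)
qed

lemma has_mellin_unique: "has_mellin f s I \<Longrightarrow> has_mellin f s J \<Longrightarrow> I = J"
  unfolding has_mellin_def by (rule has_bochner_integral_eq)

text \<open>The two exponents may differ, so that a kernel cut off at 1 can be compared with the
  uncut kernel at an exponent where its transform is known.\<close>

lemma has_mellin_dominated:
  assumes "has_mellin f s I" and [measurable]: "g \<in> borel_measurable borel"
    and "\<And>x. x > 0 \<Longrightarrow> \<bar>g x\<bar> * x powr (t - 1) \<le> \<bar>f x\<bar> * x powr (s - 1)"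
  shows "\<exists>J. has_mellin g t J"
proof -
  have "integrable lborel (\<lambda>x. indicator {0<..} x * (g x * x powr (t - 1)))"
  proof (rule Bochner_Integration.integrable_bound)
    show "integrable lborel (\<lambda>x. indicator {0<..} x * (f x * x powr (s - 1)))"
      using assms(1) by (simp add: has_mellin_def has_bochner_integral_iff)
  qed (use assms(3) in \<open>auto simp: indicator_def abs_mult\<close>)
  then show ?thesis
    by (auto simp: has_mellin_def has_bochner_integral_iff)
qed

text \<open>Bridge from gauge integrals, the form in which the Gamma and Beta integrals are given,
  to Lebesgue integrals; for nonnegative integrands the two agree.\<close>

lemma has_mellin_has_integral:
  assumes "((\<lambda>x. f x * x powr (s - 1)) has_integral I) A" and "A \<subseteq> {0..}"
    and "\<And>x. x \<in> A \<Longrightarrow> f x \<ge> 0"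
    and [measurable]: "f \<in> borel_measurable borel" "A \<in> sets borel"
  shows "has_mellin (\<lambda>x. indicator A x * f x) s I"
  unfolding has_mellin_def
proof (rule has_bochner_integral_nn_integral)
  have nonneg: "f x * x powr (s - 1) \<ge> 0" if "x \<in> A" for x
    using assms(3) that by auto
  then show "I \<ge> 0"
    using has_integral_nonneg[OF assms(1)] by auto
  show "AE x in lborel. 0 \<le> indicator {0<..} x * (indicator A x * f x * x powr (s - 1))"
    using nonneg by (auto simp: indicator_def)
  have "(\<integral>\<^sup>+x. ennreal (indicator {0<..} x * (indicator A x * f x * x powr (s - 1))) \<partial>lborel) =
        (\<integral>\<^sup>+x. ennreal (indicator A x * (f x * x powr (s - 1))) \<partial>lborel)"
  proof (rule nn_integral_cong)
    fix x :: real
    \<comment> \<open>The indicators can differ only at 0, where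
      \<open>0 powr (s - 1) = 0\<close>.\<close>
    show "ennreal (indicator {0<..} x * (indicator A x * f x * x powr (s - 1))) =
          ennreal (indicator A x * (f x * x powr (s - 1)))"
      using assms(2) by (cases "x = 0") (auto simp: indicator_def)
  qed
  also have "\<dots> = I"
    by (rule nn_integral_has_integral_lebesgue[OF nonneg assms(1)])
  finally show "(\<integral>\<^sup>+x. ennreal (indicator {0<..} x * (indicator A x * f x * x powr (s - 1))) \<partial>lborel) = I" .
qed auto

text \<open>Nonnegativity makes each integral of a norm equal to \<open>I n\<close>, so convergence
  of \<open>I\<close> is all that termwise integration requires.\<close>

lemma has_mellin_sums:
  fixes f :: "nat \<Rightarrow> real \<Rightarrow> real"
  assumes f: "\<And>n. has_mellin (f n) s (I n)" and nonneg: "\<And>n x. x > 0 \<Longrightarrow> f n x \<ge> 0"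
    and I: "I sums J" and g: "\<And>x. x > 0 \<Longrightarrow> (\<lambda>n. f n x) sums g x"
  shows "has_mellin g s J"
proof -
  let ?f = "\<lambda>n x. indicator {0<..} x * (f n x * x powr (s - 1))"
  have int: "integrable lborel (?f n)" and I_eq: "integral\<^sup>L lborel (?f n) = I n" for n
    using f[of n] by (auto simp: has_mellin_def has_bochner_integral_iff)
  have sums: "(\<lambda>n. ?f n x) sums (indicator {0<..} x * (g x * x powr (s - 1)))" for x
    using sums_mult2[OF g[of x], of "x powr (s - 1)"] by (auto simp: indicator_def)
  have norm: "norm (?f n x) = ?f n x" for n x
    using nonneg[of x n] by (auto simp: indicator_def)
  have 1: "AE x in lborel. summable (\<lambda>n. norm (?f n x))"
    unfolding norm using sums by (auto simp: sums_iff)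
  have 2: "summable (\<lambda>n. LINT x|lborel. norm (?f n x))"
    unfolding norm I_eq using I by (simp add: sums_iff)
  have eq: "(\<lambda>x. \<Sum>n. ?f n x) = (\<lambda>x. indicator {0<..} x * (g x * x powr (s - 1)))"
    using sums by (auto simp: sums_iff fun_eq_iff)
  show ?thesis
    unfolding has_mellin_def has_bochner_integral_iff
    using integrable_suminf[OF int 1 2] sums_integral[OF int 1 2] I
    unfolding eq I_eq by (auto dest: sums_unique2)
qed

lemma exp_abs_ln_le: "x > 0 \<Longrightarrow> exp (r * \<bar>ln x\<bar>) \<le> x powr r + x powr (-r :: real)"
  by (cases "ln x \<ge> 0") (auto simp: powr_def abs_if intro: add_increasing add_increasing2)

text \<open>
  Expanding \<open>x powr (w - z)\<close> in powers of \<open>w - z\<close> and integrating termwise gives a power series;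
  the partial sums are dominated because \<open>exp (r * \<bar>ln x\<bar>)\<close> is at most \<open>x powr r + x powr (- r)\<close>.
\<close>
lemma mellin_holomorphic:
  assumes "open T" and "\<And>t. t \<in> T \<Longrightarrow> \<exists>I. has_mellin f t I"
  shows "mellin f holomorphic_on {s. Re s \<in> T}"
proof -
  have ex: "\<exists>r>0. mellin f holomorphic_on ball z r" if z: "Re z \<in> T" for z
  proof -
    obtain r where "r > 0" and r: "ball (Re z) r \<subseteq> T"
      using \<open>open T\<close> z open_contains_ball by blast
    define F where "F = (\<lambda>x. complex_of_real (indicator {0<..} x * f x) * exp ((z - 1) * of_real (ln x)))"
    \<comment> \<open>These are the Taylor coefficients of \<open>mellin f\<close> at
      \<open>z\<close>.\<close>
    define c where "c = (\<lambda>n. LINT x|lborel. F x * (of_real (ln x) ^ n / fact n))"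
    have sums: "(\<lambda>n. c n * (w - z) ^ n) sums mellin f w" if w: "w \<in> ball z r" for w
    proof -
      define q where "q = norm (w - z)"
      have q: "0 \<le> q" "q < r" using w by (auto simp: q_def dist_norm norm_minus_commute)
      let ?G = "\<lambda>t x. indicator {0<..} x * (f x * x powr (t - 1))"
      have int: "integrable lborel (?G t)" if "t \<in> T" for t
        using assms(2)[OF that] by (auto simp: has_mellin_def has_bochner_integral_iff)
      define H where "H = (\<lambda>x. \<bar>?G (Re z + q) x\<bar> + \<bar>?G (Re z - q) x\<bar>)"
      have H: "integrable lborel H"
        unfolding H_def using q by (intro Bochner_Integration.integrable_add integrable_abs int subsetD[OF r]) (auto simp: dist_real_def)
      \<comment> \<open>Measurability of \<open>F\<close> comes from integrability of the real
        integrand at \<open>Re z\<close>, from which \<open>F\<close> differs by a unimodular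
        factor.\<close>
      have "(\<lambda>x. complex_of_real (?G (Re z) x) * exp (\<i> * of_real (Im z * ln x))) \<in> borel_measurable lborel"
        using borel_measurable_integrable[OF int[OF z]] by measurable
      also have "(\<lambda>x. complex_of_real (?G (Re z) x) * exp (\<i> * of_real (Im z * ln x))) = F"
      proof
        fix x :: real
        show "complex_of_real (?G (Re z) x) * exp (\<i> * of_real (Im z * ln x)) = F x"
        proof (cases "x > 0")
          case True
          have "(z - 1) * complex_of_real (ln x) = of_real ((Re z - 1) * ln x) + \<i> * of_real (Im z * ln x)"
            by (simp add: complex_eq_iff algebra_simps)
          then have "exp ((z - 1) * complex_of_real (ln x)) =
              of_real (x powr (Re z - 1)) * exp (\<i> * of_real (Im z * ln x))"
            using True by (simp only: exp_add exp_of_real powr_def) simp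
          then show ?thesis
            using True by (simp add: F_def)
        qed (simp add: F_def)
      qed
      finally have F_meas [measurable]: "F \<in> borel_measurable lborel" .
      define e where "e = (\<lambda>n x. (w - z) ^ n * of_real (ln x) ^ n / fact n :: complex)"
      have [measurable]: "e n \<in> borel_measurable lborel" for n
        unfolding e_def by measurable
      have e_sum: "norm (\<Sum>n<N. e n x) \<le> exp (q * \<bar>ln x\<bar>)" for N x
      proof -
        have "norm (\<Sum>n<N. e n x) \<le> (\<Sum>n<N. (q * \<bar>ln x\<bar>) ^ n /\<^sub>R fact n)"
          by (rule sum_norm_le)
             (simp add: e_def norm_mult norm_divide norm_power q_def power_mult_distrib field_simps)
        also have "\<dots> \<le> exp (q * \<bar>ln x\<bar>)"
          unfolding exp_def using q
          by (intro sum_le_suminf summable_exp_generic) auto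
        finally show ?thesis .
      qed
      have F_norm: "norm (F x) * exp (q * \<bar>ln x\<bar>) \<le> H x" for x
      proof (cases "x > 0")
        case True
        have "norm (F x) = \<bar>f x\<bar> * x powr (Re z - 1)"
          using True by (simp add: F_def norm_mult powr_def)
        then have "norm (F x) * exp (q * \<bar>ln x\<bar>) \<le> \<bar>f x\<bar> * x powr (Re z - 1) * (x powr q + x powr (-q))"
          using exp_abs_ln_le[OF True, of q] by (simp add: mult_left_mono)
        also have "\<dots> = H x"
          using True by (simp add: H_def abs_mult powr_add[symmetric] algebra_simps)
        finally show ?thesis .
      qed (simp add: F_def H_def)
      have dom: "norm (F x * (\<Sum>n<N. e n x)) \<le> H x" for N x
        using mult_left_mono[OF e_sum norm_ge_zero[of "F x"]] F_norm[of x]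
        unfolding norm_mult by (rule order_trans)
      have lim: "(\<lambda>N. F x * (\<Sum>n<N. e n x)) \<longlonglongrightarrow> F x * exp ((w - z) * of_real (ln x))" for x
      proof -
        have "e n x = ((w - z) * complex_of_real (ln x)) ^ n /\<^sub>R fact n" for n
          by (simp only: e_def power_mult_distrib scaleR_conv_of_real of_real_inverse of_real_fact divide_inverse) (rule mult.commute)
        then show ?thesis
          using exp_converges[of "(w - z) * complex_of_real (ln x)"]
          by (intro tendsto_intros) (simp only: sums_def)
      qed
      have int_term: "integrable lborel (\<lambda>x. F x * e n x)" for n
      proof (rule Bochner_Integration.integrable_bound[OF Bochner_Integration.integrable_add[OF H H]])
        have "norm (F x * e n x) \<le> norm (H x + H x)" for x
        proof -
          \<comment> \<open>A single term is the difference of two consecutive partial sums, each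
            bounded by \<open>H\<close>.\<close>
          have "F x * e n x = F x * (\<Sum>n<Suc n. e n x) - F x * (\<Sum>n<n. e n x)"
            by (simp add: algebra_simps)
          also have "norm \<dots> \<le> H x + H x"
            by (rule order_trans[OF norm_triangle_ineq4]) (rule add_mono[OF dom dom])
          finally show ?thesis by simp
        qed
        then show "AE x in lborel. norm (F x * e n x) \<le> norm (H x + H x)" by simp
      qed measurable
      have "(\<lambda>N. LINT x|lborel. F x * (\<Sum>n<N. e n x)) \<longlonglongrightarrow>
            (LINT x|lborel. F x * exp ((w - z) * of_real (ln x)))"
        by (rule integral_dominated_convergence[where w = H]) (use H lim dom in auto)
      also have "(LINT x|lborel. F x * exp ((w - z) * of_real (ln x))) = mellin f w"
        unfolding mellin_def F_def
        by (intro Bochner_Integration.integral_cong refl)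
           (simp add: mult.assoc exp_add[symmetric] algebra_simps)
      also have "(\<lambda>N. LINT x|lborel. F x * (\<Sum>n<N. e n x)) = (\<lambda>N. \<Sum>n<N. c n * (w - z) ^ n)"
      proof
        fix N
        have "(LINT x|lborel. F x * (\<Sum>n<N. e n x)) = (\<Sum>n<N. LINT x|lborel. F x * e n x)"
          unfolding sum_distrib_left by (rule Bochner_Integration.integral_sum[OF int_term])
        also have "\<dots> = (\<Sum>n<N. c n * (w - z) ^ n)"
        proof (rule sum.cong[OF refl])
          fix n
          have "(LINT x|lborel. F x * e n x) = (LINT x|lborel. F x * (of_real (ln x) ^ n / fact n) * (w - z) ^ n)"
            by (intro Bochner_Integration.integral_cong refl) (simp add: e_def)
          then show "(LINT x|lborel. F x * e n x) = c n * (w - z) ^ n"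
            by (simp add: c_def)
        qed
        finally show "(LINT x|lborel. F x * (\<Sum>n<N. e n x)) = (\<Sum>n<N. c n * (w - z) ^ n)" .
      qed
      finally show ?thesis unfolding sums_def .
    qed
    show ?thesis
      using power_series_holomorphic[OF sums] \<open>r > 0\<close> by blast
  qed
  show ?thesis
    unfolding holomorphic_on_def
  proof safe
    fix z assume "Re z \<in> T"
    from ex[OF this] obtain r where "r > 0" "mellin f holomorphic_on ball z r"
      by blast
    then show "mellin f field_differentiable at z within {s. Re s \<in> T}"
      using holomorphic_on_imp_differentiable_at[of "mellin f" "ball z r" z]
      by (simp add: field_differentiable_at_within)
  qed
qed

text \<open>The midpoint of the interval is a limit point of it, so the identity theorem applies.
  Every complex identity about zeta below is obtained by checking it on a real interval
  first.\<close>

lemma holomorphic_eq_if_eq_on_reals: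
  fixes f g :: "complex \<Rightarrow> complex"
  assumes "f holomorphic_on S" "g holomorphic_on S" "open S" "connected S" and "a < b"
    and in_S: "\<And>x. a < x \<Longrightarrow> x < b \<Longrightarrow> complex_of_real x \<in> S"
    and eq: "\<And>x. a < x \<Longrightarrow> x < b \<Longrightarrow> f (of_real x) = g (of_real x)"
    and "z \<in> S"
  shows "f z = g z"
proof -
  define m where "m = (a + b) / 2"
  have "complex_of_real m islimpt (complex_of_real ` {a<..<b})"
    unfolding islimpt_approachable
  proof safe
    fix e :: real assume "e > 0"
    define x where "x = m + min (e / 2) ((b - a) / 4)"
    have "x \<in> {a<..<b}" "x \<noteq> m" "dist x m < e"
      using \<open>e > 0\<close> \<open>a < b\<close> by (auto simp: x_def m_def dist_real_def field_simps min_def)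
    then show "\<exists>y\<in>complex_of_real ` {a<..<b}. y \<noteq> of_real m \<and> dist y (of_real m) < e"
      by (intro bexI[of _ "of_real x"]) (auto simp: dist_of_real)
  qed
  moreover have "(\<lambda>z. f z - g z) holomorphic_on S"
    using assms by (intro holomorphic_intros)
  moreover have "complex_of_real ` {a<..<b} \<subseteq> S" "complex_of_real m \<in> S"
    using in_S \<open>a < b\<close> by (auto simp: m_def simp del: of_real_divide of_real_add)
  moreover have "f w - g w = 0" if "w \<in> complex_of_real ` {a<..<b}" for w
    using that eq by auto
  ultimately have "f z - g z = 0"
    using analytic_continuation[of "\<lambda>z. f z - g z" S "complex_of_real ` {a<..<b}" "of_real m" z] assms(3,4,8)
    by blast
  then show ?thesis by simp
qed

lemma has_mellin_scale:
  assumes "has_mellin f s I" and "a > 0"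
  shows "has_mellin (\<lambda>x. f (a * x)) s (I / a powr s)"
proof -
  have "has_bochner_integral lborel
      (\<lambda>x. a powr (1 - s) * (indicator {0<..} (0 + a * x) * (f (0 + a * x) * (0 + a * x) powr (s - 1))))
      (a powr (1 - s) * (I /\<^sub>R \<bar>a\<bar>))"
    using assms lborel_has_bochner_integral_real_affine_iff[of a _ I 0]
    by (intro has_bochner_integral_mult_right) (auto simp: has_mellin_def)
  also have "a powr (1 - s) * (I /\<^sub>R \<bar>a\<bar>) = I / a powr s"
    using assms(2) by (simp add: powr_diff field_simps)
  also have "(\<lambda>x. a powr (1 - s) * (indicator {0<..} (0 + a * x) * (f (0 + a * x) * (0 + a * x) powr (s - 1)))) =
      (\<lambda>x. indicator {0<..} x * (f (a * x) * x powr (s - 1)))"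
  proof
    fix x :: real
    have "a powr (1 - s) * a powr (s - 1) = 1"
      using assms(2) by (simp flip: powr_add)
    then show "a powr (1 - s) * (indicator {0<..} (0 + a * x) * (f (0 + a * x) * (0 + a * x) powr (s - 1))) =
        indicator {0<..} x * (f (a * x) * x powr (s - 1))"
      using assms(2) by (cases "x > 0") (auto simp: indicator_def powr_mult zero_less_mult_iff)
  qed
  finally show ?thesis unfolding has_mellin_def .
qed

section \<open>Explicit Mellin transforms of exponential and rational kernels\<close>

lemma has_mellin_exp:
  assumes "s > 0" "a > 0"
  shows "has_mellin (\<lambda>x. exp (- (a * x))) s (Gamma s / a powr s)"
proof -
  have "((\<lambda>x. exp (- x) * x powr (s - 1)) has_integral Gamma s) {0..}"
    using Gamma_integral_real[OF assms(1)] by (simp add: exp_minus field_simps)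
  then have "has_mellin (\<lambda>x. indicator {0..} x * exp (- x)) s (Gamma s)"
    by (rule has_mellin_has_integral) auto
  then have "has_mellin (\<lambda>x. exp (- x)) s (Gamma s)"
    by (subst has_mellin_cong[where g = "\<lambda>x. indicator {0..} x * exp (- x)"]) auto
  from has_mellin_scale[OF this assms(2)] show ?thesis .
qed

lemma summable_Dirichlet_real: "s > 1 \<Longrightarrow> summable (\<lambda>n. 1 / real (Suc n) powr s)"
  using summable_real_powr_iff[of "-s"] summable_Suc_iff[of "\<lambda>n. real n powr (-s)"]
  by (simp add: powr_minus_divide)

text \<open>Geometric series in \<open>exp (- x)\<close> without its constant term, integrated
  termwise.\<close>

lemma has_mellin_bose:
  assumes "s > 1"
  shows "has_mellin (\<lambda>x. 1 / (exp x - 1)) s (Gamma s * (\<Sum>n. 1 / real (Suc n) powr s))"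
proof (rule has_mellin_sums)
  show "has_mellin (\<lambda>x. exp (- (real (Suc n) * x))) s (Gamma s / real (Suc n) powr s)" for n
    using assms by (intro has_mellin_exp) auto
  show "(\<lambda>n. Gamma s / real (Suc n) powr s) sums (Gamma s * (\<Sum>n. 1 / real (Suc n) powr s))"
    using sums_mult[OF summable_sums[OF summable_Dirichlet_real[OF assms]], of "Gamma s"] by simp
  show "(\<lambda>n. exp (- (real (Suc n) * x))) sums (1 / (exp x - 1))" if "x > 0" for x :: real
  proof -
    have "exp (- x) * exp (- x) ^ n = exp (- (real (Suc n) * x))" for n
      by (simp add: exp_of_nat_mult[symmetric] exp_add[symmetric] algebra_simps)
    moreover have "exp (- x) * (1 / (1 - exp (- x))) = 1 / (exp x - 1)"
      using that by (simp add: exp_minus field_simps)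
    ultimately show ?thesis
      using sums_mult[OF geometric_sums[of "exp (- x)"], of "exp (- x)"] that by simp
  qed
qed auto

text \<open>The substitution \<open>t = x^2 / (x^2 + 1)\<close> maps the positive half-line onto the
  unit interval and yields \<open>Beta p q\<close> with \<open>p = (1 + s) / 2\<close> and
  \<open>q = 1 - p\<close>. The reflection formula evaluates it as
  \<open>pi / sin (pi * p)\<close>.\<close>

lemma has_mellin_rational_1:
  assumes "-1 < s" "s < 1"
  shows "has_mellin (\<lambda>x. 2 * x / (x\<^sup>2 + 1)) s (pi / cos (pi * s / 2))"
proof -
  define p where "p = (1 + s) / 2"
  define q where "q = (1 - s) / 2"
  have pq: "p > 0" "q > 0" "q = 1 - p" using assms by (auto simp: p_def q_def field_simps)
  define g where "g = (\<lambda>x::real. x\<^sup>2 / (x\<^sup>2 + 1))"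
  define g' where "g' = (\<lambda>x::real. 2 * x / (x\<^sup>2 + 1)\<^sup>2)"
  define f where "f = (\<lambda>t::real. t powr (p - 1) * (1 - t) powr (q - 1))"
  have pos: "x\<^sup>2 + 1 > 0" for x :: real
    by (simp add: add_nonneg_pos)
  have Beta: "Beta p q = pi / cos (pi * s / 2)"
  proof -
    have "complex_of_real (Gamma p * Gamma q) = of_real (pi / sin (pi * p))"
    proof -
      have "complex_of_real q = 1 - of_real p" by (simp add: pq(3))
      moreover have "sin (of_real pi * of_real p) = complex_of_real (sin (pi * p))"
        by (metis of_real_mult sin_of_real)
      ultimately show ?thesis
        using Gamma_reflection_complex[of "of_real p"]
        by (metis Gamma_complex_of_real of_real_divide of_real_mult)
    qed
    then have "Gamma p * Gamma q = pi / sin (pi * p)"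
      using of_real_eq_iff by blast
    moreover have "sin (pi * p) = cos (pi * s / 2)"
      unfolding p_def by (simp add: sin_cos_eq field_simps)
    ultimately show ?thesis
      by (simp add: Beta_def pq)
  qed
  have deriv: "(g has_field_derivative g' x) (at x within {0<..})" for x
    unfolding g_def g'_def using pos[of x]
    by (auto intro!: derivative_eq_intros simp: field_simps power2_eq_square power3_eq_cube)
  have image: "g ` {0<..} = {0<..<1}"
  proof safe
    fix t :: real assume t: "t \<in> {0<..<1}"
    then have "g (sqrt (t / (1 - t))) = t"
      by (simp add: g_def field_simps)
    then show "t \<in> g ` {0<..}"
      using t by (intro image_eqI[of _ _ "sqrt (t / (1 - t))"]) auto
  qed (use pos in \<open>auto simp: g_def field_simps\<close>)
  have inj: "inj_on g {0<..}"
  proof (rule inj_onI)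
    fix x y :: real assume "x \<in> {0<..}" "y \<in> {0<..}" "g x = g y"
    then show "x = y"
      using pos[of x] pos[of y] by (auto simp: g_def field_simps power2_eq_iff)
  qed
  have f_int: "(f has_integral Beta p q) {0<..<1}"
    using has_integral_Beta_real[OF pq(1,2)] by (simp add: f_def has_integral_Icc_iff_Ioo)
  have "f absolutely_integrable_on {0<..<1}"
    using f_int by (intro nonnegative_absolutely_integrable_1) (auto simp: f_def has_integral_iff)
  with f_int have "(\<lambda>x. \<bar>g' x\<bar> * f (g x)) absolutely_integrable_on {0<..} \<and>
      integral {0<..} (\<lambda>x. \<bar>g' x\<bar> * f (g x)) = Beta p q"
    by (subst has_absolute_integral_change_of_variables_1'[OF _ deriv inj])
       (auto simp: image has_integral_iff)
  then have "((\<lambda>x. \<bar>g' x\<bar> * f (g x)) has_integral Beta p q) {0<..}"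
    by (auto simp: has_integral_iff set_lebesgue_integral_eq_integral(1))
  moreover have "\<bar>g' x\<bar> * f (g x) = 2 * x / (x\<^sup>2 + 1) * x powr (s - 1)" if "x \<in> {0<..}" for x
  proof -
    have x: "x > 0" using that by simp
    have "1 - g x = 1 / (x\<^sup>2 + 1)"
      using pos[of x] by (simp add: g_def field_simps)
    then have "f (g x) = (x\<^sup>2) powr (p - 1) / ((x\<^sup>2 + 1) powr (p - 1) * (x\<^sup>2 + 1) powr (q - 1))"
      using pos[of x] x by (simp add: f_def g_def powr_divide)
    also have "(x\<^sup>2 + 1) powr (p - 1) * (x\<^sup>2 + 1) powr (q - 1) = (x\<^sup>2 + 1) powr (-1)"
      by (simp add: pq(3) flip: powr_add)
    also have "(x\<^sup>2) powr (p - 1) = x powr (s - 1)"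
    proof -
      have "(x\<^sup>2) powr (p - 1) = x powr (2 * (p - 1))"
        using x powr_powr[of x 2 "p - 1"] by simp
      also have "2 * (p - 1) = s - 1" by (simp add: p_def field_simps)
      finally show ?thesis .
    qed
    finally have "f (g x) = x powr (s - 1) * (x\<^sup>2 + 1)"
      using pos[of x] by (simp add: powr_minus_divide)
    then show ?thesis
      using x pos[of x] by (simp add: g'_def power2_eq_square[of "x\<^sup>2 + 1"])
  qed
  ultimately have "((\<lambda>x. 2 * x / (x\<^sup>2 + 1) * x powr (s - 1)) has_integral Beta p q) {0<..}"
    by (rule has_integral_eq[rotated])
  then have "has_mellin (\<lambda>x. indicator {0<..} x * (2 * x / (x\<^sup>2 + 1))) s (Beta p q)"
    by (rule has_mellin_has_integral) auto
  then show ?thesis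
    by (subst has_mellin_cong[where g = "\<lambda>x. indicator {0<..} x * (2 * x / (x\<^sup>2 + 1))"])
       (auto simp: Beta)
qed

lemma has_mellin_rational:
  assumes "-1 < s" "s < 1" "a > 0"
  shows "has_mellin (\<lambda>x. 2 * x / (x\<^sup>2 + a\<^sup>2)) s (a powr (s - 1) * (pi / cos (pi * s / 2)))"
proof -
  have "has_mellin (\<lambda>x. 1 / a * (2 * (1 / a * x) / ((1 / a * x)\<^sup>2 + 1))) s
      (1 / a * (pi / cos (pi * s / 2) / (1 / a) powr s))"
    using assms by (intro has_mellin_cmult has_mellin_scale has_mellin_rational_1) auto
  also have "(\<lambda>x. 1 / a * (2 * (1 / a * x) / ((1 / a * x)\<^sup>2 + 1))) = (\<lambda>x. 2 * x / (x\<^sup>2 + a\<^sup>2))"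
  proof
    fix x
    have "x\<^sup>2 + a\<^sup>2 > 0" using assms(3) by (simp add: add_nonneg_pos)
    then show "1 / a * (2 * (1 / a * x) / ((1 / a * x)\<^sup>2 + 1)) = 2 * x / (x\<^sup>2 + a\<^sup>2)"
      using assms(3) by (simp add: field_simps power2_eq_square)
  qed
  also have "1 / a * (pi / cos (pi * s / 2) / (1 / a) powr s) = a powr (s - 1) * (pi / cos (pi * s / 2))"
    using assms(3) by (simp add: powr_divide powr_diff)
  finally show ?thesis .
qed

section \<open>Partial fractions of the hyperbolic cotangent and their Mellin transform\<close>

text \<open>Differentiate \<open>rGamma z * rGamma (1 - z) = sin (pi * z) / pi\<close>, the left
  side by the product rule.\<close>

lemma Digamma_reflection:
  fixes z :: complex
  assumes "z \<notin> \<int>"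
  shows "(Digamma (1 - z) - Digamma z) * sin (of_real pi * z) = of_real pi * cos (of_real pi * z)"
proof -
  have z: "z \<notin> \<int>\<^sub>\<le>\<^sub>0" "1 - z \<notin> \<int>\<^sub>\<le>\<^sub>0"
    using assms nonpos_Ints_Int Ints_diff[of 1 "1 - z"] by (auto simp: nonpos_Ints_Int)
  have "((\<lambda>z. rGamma z * rGamma (1 - z)) has_field_derivative
      (- rGamma z * Digamma z) * rGamma (1 - z) + rGamma z * (rGamma (1 - z) * Digamma (1 - z))) (at z)"
    using z by (auto intro!: derivative_eq_intros)
  moreover have "((\<lambda>z. rGamma z * rGamma (1 - z)) has_field_derivative cos (of_real pi * z)) (at z)"
    unfolding rGamma_reflection_complex by (auto intro!: derivative_eq_intros)
  ultimately have "rGamma z * rGamma (1 - z) * (Digamma (1 - z) - Digamma z) = cos (of_real pi * z)"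
    using DERIV_unique by (fastforce simp: algebra_simps)
  then show ?thesis
    unfolding rGamma_reflection_complex by (simp add: field_simps)
qed

text \<open>The limit is \<open>coth (x / 2) / 2 - 1 / x\<close>. Subtracting the digamma series at
  \<open>1 + z\<close> from that at \<open>1 - z\<close>, with \<open>z\<close> imaginary, gives
  \<open>pi * cot (pi * z) - 1 / z\<close> by recurrence and reflection.\<close>

lemma coth_partial_fractions:
  fixes x :: real
  assumes "x > 0"
  shows "(\<lambda>n. 2 * x / (x\<^sup>2 + (2 * pi * real (Suc n))\<^sup>2)) sums (1 / (exp x - 1) - 1 / x + 1 / 2)"
proof -
  define y where "y = x / (2 * pi)"
  define z where "z = \<i> * complex_of_real y"
  have pi_z: "of_real pi * z = \<i> * complex_of_real (x / 2)"
    by (simp add: z_def y_def)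
  define u where "u = exp (x / 2)"
  have u: "u > 1" "exp x = u\<^sup>2"
    using assms by (auto simp: u_def power2_eq_square simp flip: exp_add)
  have "u * u > 1" using u(1) by (simp add: less_1_mult)
  have sin_pz: "sin (of_real pi * z) = \<i> * complex_of_real ((u - inverse u) / 2)"
    and cos_pz: "cos (of_real pi * z) = complex_of_real ((u + inverse u) / 2)"
    unfolding pi_z sin_i_times cos_i_times exp_of_real u_def by simp_all
  have "u - inverse u > 0" using \<open>u * u > 1\<close> u(1) by (simp add: field_simps)
  have y: "y > 0" using assms by (simp add: y_def)
  have z: "z \<notin> \<int>" "z \<noteq> 0" "1 - z \<noteq> 0" "1 + z \<noteq> 0"
    using y by (auto simp: z_def complex_eq_iff elim!: Ints_cases)
  have D: "(\<lambda>k. inverse (of_nat (Suc k)) - inverse (w + of_nat k)) sums (Digamma w + euler_mascheroni)"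
    if "w \<noteq> 0" for w :: complex
    using summable_sums[OF summable_Digamma[OF that]] by (simp add: Digamma_def del: of_nat_Suc)
  have "(\<lambda>k. (inverse (of_nat (Suc k)) - inverse (1 - z + of_nat k)) -
        (inverse (of_nat (Suc k)) - inverse (1 + z + of_nat k)))
      sums ((Digamma (1 - z) + euler_mascheroni) - (Digamma (1 + z) + euler_mascheroni))"
    by (rule sums_diff[OF D[OF z(3)] D[OF z(4)]])
  also have "(Digamma (1 - z) + euler_mascheroni) - (Digamma (1 + z) + euler_mascheroni) =
      Digamma (1 - z) - Digamma z - 1 / z"
    using Digamma_plus1[OF z(2)] by (simp add: add.commute)
  also have "Digamma (1 - z) - Digamma z = of_real pi * cos (of_real pi * z) / sin (of_real pi * z)"
  proof -
    have "sin (of_real pi * z) \<noteq> 0"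
      using \<open>u - inverse u > 0\<close> by (simp add: sin_pz del: of_real_divide of_real_diff of_real_inverse)
    then show ?thesis
      using Digamma_reflection[OF z(1)] by (simp add: field_simps)
  qed
  \<comment> \<open>The factor makes everything real: at \<open>pi * z = i * x / 2\<close> the
    cotangent is \<open>- i * coth (x / 2)\<close>, and
    \<open>i / (2 * pi * z) = 1 / x\<close>.\<close>
  finally have sums: "(\<lambda>k. \<i> / (2 * of_real pi) * ((inverse (of_nat (Suc k)) - inverse (1 - z + of_nat k)) -
        (inverse (of_nat (Suc k)) - inverse (1 + z + of_nat k))))
      sums (\<i> / (2 * of_real pi) * (of_real pi * cos (of_real pi * z) / sin (of_real pi * z) - 1 / z))"
    by (rule sums_mult)
  have lim: "\<i> / (2 * of_real pi) * (of_real pi * cos (of_real pi * z) / sin (of_real pi * z) - 1 / z) =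
      complex_of_real (1 / (exp x - 1) - 1 / x + 1 / 2)"
  proof -
    have "\<i> / (2 * of_real pi) * (of_real pi * cos (of_real pi * z) / sin (of_real pi * z) - 1 / z) =
        complex_of_real (1 / 2 * (u + inverse u) / (u - inverse u) - 1 / x)"
    proof -
      define c d where "c = (u + inverse u) / 2" and "d = (u - inverse u) / 2"
      have "d \<noteq> 0" using \<open>u - inverse u > 0\<close> by (simp add: d_def)
      then have "\<i> / (2 * of_real pi) * (of_real pi * of_real c / (\<i> * of_real d) - 1 / z) =
          complex_of_real (1 / 2 * c / d - 1 / x)"
        using assms by (simp add: z_def y_def field_simps)
      moreover have "1 / 2 * (u + inverse u) / (u - inverse u) = 1 / 2 * c / d"
      proof -
        have "u + inverse u = 2 * c" "u - inverse u = 2 * d"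
          by (simp_all add: c_def d_def)
        then show ?thesis by (simp only:)
      qed
      ultimately show ?thesis
        unfolding sin_pz cos_pz c_def d_def by simp
    qed
    also have "1 / 2 * (u + inverse u) / (u - inverse u) = 1 / (u\<^sup>2 - 1) + 1 / 2"
      using \<open>u * u > 1\<close> u(1) by (simp add: field_simps power2_eq_square)
    finally show ?thesis by (simp add: u algebra_simps)
  qed
  have terms: "\<i> / (2 * of_real pi) * ((inverse (of_nat (Suc n)) - inverse (1 - z + of_nat n)) -
        (inverse (of_nat (Suc n)) - inverse (1 + z + of_nat n))) =
      complex_of_real (2 * x / (x\<^sup>2 + (2 * pi * real (Suc n))\<^sup>2))" for n
  proof -
    have "x\<^sup>2 + (2 * pi * real (Suc n))\<^sup>2 = (2 * pi)\<^sup>2 * (y\<^sup>2 + (real (Suc n))\<^sup>2)"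
      by (simp add: y_def power2_eq_square field_simps)
    moreover have "inverse (1 + z + of_nat n) - inverse (1 - z + of_nat n) =
        - (2 * \<i> * y / complex_of_real (y\<^sup>2 + (real (Suc n))\<^sup>2))"
    proof -
      have "1 + z + of_nat n \<noteq> 0" "1 - z + of_nat n \<noteq> 0"
        using y by (auto simp: z_def complex_eq_iff)
      moreover have "complex_of_real (y\<^sup>2 + (real (Suc n))\<^sup>2) = (1 + z + of_nat n) * (1 - z + of_nat n)"
        by (simp add: z_def complex_eq_iff power2_eq_square algebra_simps)
      ultimately show ?thesis
        by (simp add: inverse_eq_divide diff_frac_eq) (simp add: z_def)
    qed
    moreover have "complex_of_real y = of_real x / (2 * of_real pi)"
      by (simp add: y_def)
    ultimately show ?thesis
      by (simp add: power2_eq_square del: of_nat_Suc of_real_add)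
  qed
  from sums show ?thesis
    unfolding lim terms sums_of_real_iff .
qed

text \<open>Each partial fraction contributes a constant times
  \<open>real (Suc n) powr (s - 1)\<close>; summing them produces the Dirichlet series at
  \<open>1 - s\<close>, the source of the reflected side of the functional equation.\<close>

lemma has_mellin_coth_kernel:
  assumes "-1 < s" "s < 0"
  shows "has_mellin (\<lambda>x. 1 / (exp x - 1) - 1 / x + 1 / 2) s
    ((2 * pi) powr (s - 1) * (pi / cos (pi * s / 2)) * (\<Sum>n. 1 / real (Suc n) powr (1 - s)))"
proof (rule has_mellin_sums)
  let ?c = "(2 * pi) powr (s - 1) * (pi / cos (pi * s / 2))"
  show "has_mellin (\<lambda>x. 2 * x / (x\<^sup>2 + (2 * pi * real (Suc n))\<^sup>2)) s
      ((2 * pi * real (Suc n)) powr (s - 1) * (pi / cos (pi * s / 2)))" for n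
    using assms by (intro has_mellin_rational) auto
  have "(2 * pi * real (Suc n)) powr (s - 1) * (pi / cos (pi * s / 2)) =
      ?c * (1 / real (Suc n) powr (1 - s))" for n
  proof -
    have "(2 * pi * real (Suc n)) powr (s - 1) = (2 * pi) powr (s - 1) * real (Suc n) powr (s - 1)"
      by (rule powr_mult)
    also have "real (Suc n) powr (s - 1) = 1 / real (Suc n) powr (1 - s)"
      using powr_minus_divide[of "real (Suc n)" "1 - s"] by simp
    finally show ?thesis by simp
  qed
  then show "(\<lambda>n. (2 * pi * real (Suc n)) powr (s - 1) * (pi / cos (pi * s / 2))) sums
      (?c * (\<Sum>n. 1 / real (Suc n) powr (1 - s)))"
    using assms sums_mult[OF summable_sums[OF summable_Dirichlet_real[of "1 - s"]], of ?c] by simp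
qed (use coth_partial_fractions in auto)

lemma has_mellin_indicator_atMost_1: "s > 0 \<Longrightarrow> has_mellin (indicator {..1}) s (1 / s)"
proof -
  assume "s > 0"
  then have "((\<lambda>x. 1 * x powr (s - 1)) has_integral 1 / s) {0..1}"
    using has_integral_powr_from_0[of "s - 1" 1] by simp
  then have "has_mellin (\<lambda>x. indicator {0..1} x * 1) s (1 / s)"
    by (rule has_mellin_has_integral) auto
  then show ?thesis
    by (subst has_mellin_cong[where g = "\<lambda>x. indicator {0..1} x * 1"]) (auto simp: indicator_def)
qed

text \<open>Head and tail of a power have opposite transforms on opposite sides of 0. Adding the
  head of \<open>1 / x - 1 / 2\<close> or subtracting its tail therefore gives the same expression
  \<open>1 / (s - 1) - 1 / (2 * s)\<close>.\<close>

lemma has_mellin_indicator_greaterThan_1: "s < 0 \<Longrightarrow> has_mellin (indicator {1<..}) s (- 1 / s)"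
proof -
  assume "s < 0"
  then have "((\<lambda>x. 1 * x powr (s - 1)) has_integral - 1 / s) {1..}"
    using has_integral_powr_to_inf[of "s - 1" 1] by simp
  then have "((\<lambda>x. 1 * x powr (s - 1)) has_integral - 1 / s) {1<..}"
    by (subst has_integral_spike_set_eq[where T = "{1..}"]) (auto intro: negligible_subset[of "{1}"])
  then have "has_mellin (\<lambda>x. indicator {1<..} x * 1) s (- 1 / s)"
    by (rule has_mellin_has_integral) auto
  then show ?thesis by simp
qed

section \<open>Analytic continuation and functional equation\<close>

definition dirichlet :: "complex \<Rightarrow> complex" where
  "dirichlet s = (\<Sum>n. 1 / of_nat (Suc n) powr s)"

lemma dirichlet_of_real:
  assumes "s > 1"
  shows "dirichlet (of_real s) = of_real (\<Sum>n. 1 / real (Suc n) powr s)"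
proof -
  have "1 / of_nat (Suc n) powr of_real s = complex_of_real (1 / real (Suc n) powr s)" for n
    using powr_of_real[of "real (Suc n)" s] by simp
  then show ?thesis
    unfolding dirichlet_def by (simp only: suminf_of_real[OF summable_Dirichlet_real[OF assms]])
qed

text \<open>Comparison test on balls: the radius \<open>d\<close> is half the distance from
  \<open>Re s\<close> to 1, so real parts in the ball are at least \<open>1 + d\<close> and the
  series at \<open>1 + d\<close> dominates.\<close>

lemma dirichlet_holomorphic: "dirichlet holomorphic_on {s. Re s > 1}"
proof -
  have open_half: "open {s. Re s > 1}" by (rule open_halfspace_Re_gt)
  obtain g where g: "\<forall>s\<in>{s. Re s > 1}. (\<lambda>n. 1 / of_nat (Suc n) powr s) sums g s \<and> g field_differentiable at s"
  proof (rule series_differentiable_comparison_complex[OF open_half])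
    show "(\<lambda>s. 1 / of_nat (Suc n) powr s) field_differentiable at s" for n and s :: complex
    proof -
      have "(\<lambda>s. 1 / of_nat (Suc n) powr s) holomorphic_on UNIV"
        by (intro holomorphic_intros) (auto simp del: of_nat_Suc)
      then show ?thesis
        by (rule holomorphic_on_imp_differentiable_at) auto
    qed
    fix s :: complex assume "s \<in> {s. Re s > 1}"
    then have s: "Re s > 1" by simp
    define d where "d = (Re s - 1) / 2"
    define h where "h = (\<lambda>n. complex_of_real (1 / real (Suc n) powr (1 + d)))"
    have "d > 0" using s by (simp add: d_def)
    have "summable h"
      unfolding h_def summable_of_real_iff using \<open>d > 0\<close> by (intro summable_Dirichlet_real) simp
    moreover have "range h \<subseteq> \<real>\<^sub>\<ge>\<^sub>0"
      by (auto simp: h_def simp del: of_real_divide)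
    moreover have "norm (1 / of_nat (Suc n) powr y) \<le> norm (h n)" if "y \<in> ball s d" for n y
    proof -
      have "\<bar>Re (s - y)\<bar> < d"
        using that abs_Re_le_cmod[of "s - y"] by (simp add: dist_norm)
      then have "1 + d \<le> Re y" by (simp add: d_def field_simps abs_if split: if_splits)
      then have "real (Suc n) powr (1 + d) \<le> real (Suc n) powr Re y"
        by (intro powr_mono) auto
      moreover have "norm (of_nat (Suc n) powr y) = real (Suc n) powr Re y"
        using norm_powr_real_powr[of "of_nat (Suc n)" y] by simp
      ultimately show ?thesis
        by (simp add: h_def norm_divide field_simps del: of_nat_Suc)
    qed
    ultimately show "\<exists>d h. 0 < d \<and> summable h \<and> range h \<subseteq> \<real>\<^sub>\<ge>\<^sub>0 \<and>
        (\<forall>\<^sub>F n in sequentially. \<forall>y\<in>ball s d \<inter> {s. 1 < Re s}. norm (1 / of_nat (Suc n) powr y) \<le> cmod (h n))"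
      using \<open>d > 0\<close> by (intro exI[of _ d] exI[of _ h]) (auto simp del: of_nat_Suc)
  qed auto
  then have "g holomorphic_on {s. Re s > 1}"
    by (auto simp: holomorphic_on_def intro: field_differentiable_at_within)
  moreover have "dirichlet s = g s" if "s \<in> {s. Re s > 1}" for s
    using g that by (auto simp: dirichlet_def sums_iff)
  ultimately show ?thesis
    using holomorphic_cong by blast
qed

section \<open>Continuation of the Dirichlet series across the line Re s = 1\<close>

definition kernel0 :: "real \<Rightarrow> real" where
  "kernel0 x = indicator {..1} x * (1 / (exp x - 1) - 1 / x + 1 / 2)"

definition kernel1 :: "real \<Rightarrow> real" where
  "kernel1 x = indicator {1<..} x * (1 / (exp x - 1))"

text \<open>The kernel lives on arguments at most 1, where lowering the exponent enlarges the power;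
  it is lowered into the range in which the coth kernel has a transform.\<close>

lemma has_mellin_kernel0: "s > -1 \<Longrightarrow> \<exists>I. has_mellin kernel0 s I"
proof -
  assume s: "s > -1"
  define t where "t = min s (-1/2)"
  have t: "-1 < t" "t < 0" "t \<le> s" using s by (auto simp: t_def)
  show ?thesis
  proof (rule has_mellin_dominated[OF has_mellin_coth_kernel[OF t(1,2)]])
    fix x :: real assume "x > 0"
    then show "\<bar>kernel0 x\<bar> * x powr (s - 1) \<le> \<bar>1 / (exp x - 1) - 1 / x + 1 / 2\<bar> * x powr (t - 1)"
      using t(3) by (auto simp: kernel0_def indicator_def intro!: mult_left_mono powr_mono')
  qed (simp add: kernel0_def[abs_def])
qed

text \<open>Beyond 1 raising the exponent enlarges the power, and from 2 on the transform of
  \<open>1 / (exp x - 1)\<close> exists.\<close>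

lemma has_mellin_kernel1: "\<exists>I. has_mellin kernel1 s I"
proof (rule has_mellin_dominated[OF has_mellin_bose[of "max s 2"]])
  fix x :: real assume "x > 0"
  then show "\<bar>kernel1 x\<bar> * x powr (s - 1) \<le> \<bar>1 / (exp x - 1)\<bar> * x powr (max s 2 - 1)"
    by (auto simp: kernel1_def indicator_def intro!: divide_right_mono powr_mono)
qed (simp_all add: kernel1_def[abs_def])

text \<open>
  Splitting the Mellin integral of \<open>1 / (exp x - 1)\<close> at \<open>1\<close> and subtracting \<open>1 / x - 1 / 2\<close> near
  \<open>0\<close> continues \<open>Gamma s * dirichlet s\<close> to \<open>Re s > -1\<close>; the term \<open>- rGamma s / (2 * s)\<close> that this
  produces is written as \<open>- rGamma (s + 1) / 2\<close> to make it regular at \<open>0\<close>.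
\<close>
definition zeta_right :: "complex \<Rightarrow> complex" where
  "zeta_right s = rGamma s * (mellin kernel0 s + 1 / (s - 1) + mellin kernel1 s) - rGamma (s + 1) / 2"

text \<open>The factor called chi in the overview, in the classical form with
  \<open>2 powr s * pi powr (s - 1)\<close>; this form is regular for
  \<open>Re s < 1\<close>.\<close>

definition zeta_factor :: "complex \<Rightarrow> complex" where
  "zeta_factor s = of_real (2 * pi) powr s / of_real pi * Gamma (1 - s) * sin (of_real pi * s / 2)"

lemma zeta_right_holomorphic: "zeta_right holomorphic_on {s. Re s > -1} - {1}"
proof -
  have "mellin kernel0 holomorphic_on {s. Re s \<in> {-1<..}}"
    by (rule mellin_holomorphic) (auto intro: has_mellin_kernel0)
  moreover have "mellin kernel1 holomorphic_on {s. Re s \<in> UNIV}"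
    by (rule mellin_holomorphic) (auto intro: has_mellin_kernel1)
  ultimately have "mellin kernel0 holomorphic_on {s. Re s > -1} - {1}"
      "mellin kernel1 holomorphic_on {s. Re s > -1} - {1}"
    by (auto elim: holomorphic_on_subset)
  then show ?thesis
    unfolding zeta_right_def[abs_def] by (intro holomorphic_intros) auto
qed

lemma zeta_factor_holomorphic: "zeta_factor holomorphic_on {s. Re s < 1}"
proof -
  have "1 - s \<notin> \<int>\<^sub>\<le>\<^sub>0" if "Re s < 1" for s
    using that by (auto elim!: nonpos_Ints_cases simp: complex_eq_iff)
  then show ?thesis
    unfolding zeta_factor_def[abs_def] by (auto intro!: holomorphic_intros)
qed

lemma zeta_right_eq_dirichlet:
  assumes "Re s > 1"
  shows "zeta_right s = dirichlet s"
proof (rule holomorphic_eq_if_eq_on_reals[where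
    f = zeta_right and g = dirichlet and z = s and a = 1 and b = 2 and S = "{s. Re s > 1}"])
  show "zeta_right holomorphic_on {s. Re s > 1}"
    by (rule holomorphic_on_subset[OF zeta_right_holomorphic]) auto
  show "connected {s. Re s > 1}" by (intro convex_connected convex_halfspace_Re_gt)
  fix t :: real assume t: "1 < t" "t < 2"
  obtain I0 I1 where I: "has_mellin kernel0 t I0" "has_mellin kernel1 t I1"
    using has_mellin_kernel0[of t] has_mellin_kernel1[of t] t by auto
  \<comment> \<open>Restoring the head of \<open>1 / x - 1 / 2\<close> recovers
    \<open>1 / (exp x - 1)\<close>; the head of \<open>1 / x\<close> converges because
    \<open>t > 1\<close>.\<close>
  have "has_mellin (\<lambda>x. kernel0 x + indicator {..1} x / x + (-1/2) * indicator {..1} x + kernel1 x) t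
      (I0 + 1 / (t - 1) + (-1/2) * (1 / t) + I1)"
    using t by (intro has_mellin_add has_mellin_cmult has_mellin_shift[THEN iffD2]
        has_mellin_indicator_atMost_1 I) auto
  also have "?this \<longleftrightarrow> has_mellin (\<lambda>x. 1 / (exp x - 1)) t (I0 + 1 / (t - 1) + (-1/2) * (1 / t) + I1)"
    by (rule has_mellin_cong) (auto simp: kernel0_def kernel1_def indicator_def)
  finally have "Gamma t * (\<Sum>n. 1 / real (Suc n) powr t) = I0 + 1 / (t - 1) + (-1/2) * (1 / t) + I1"
    using has_mellin_bose[OF t(1)] has_mellin_unique by blast
  then have Gamma_dirichlet: "Gamma (complex_of_real t) * dirichlet (of_real t) =
      mellin kernel0 (of_real t) + 1 / (of_real t - 1) - 1 / (2 * of_real t) + mellin kernel1 (of_real t)"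
    unfolding Gamma_complex_of_real dirichlet_of_real[OF t(1)] mellin_of_real[OF I(1)] mellin_of_real[OF I(2)]
    by (simp flip: of_real_mult) simp
  have "rGamma (complex_of_real t) * Gamma (of_real t) = 1"
  proof -
    have "complex_of_real t \<notin> \<int>\<^sub>\<le>\<^sub>0"
      using t by (auto elim!: nonpos_Ints_cases simp: complex_eq_iff)
    then show ?thesis
      by (simp add: rGamma_inverse_Gamma Gamma_eq_zero_iff)
  qed
  moreover have "rGamma (of_real t + 1) = rGamma (complex_of_real t) / of_real t"
    using rGamma_plus1[of "complex_of_real t"] t by (simp add: field_simps)
  moreover have "mellin kernel0 (of_real t) + 1 / (of_real t - 1) + mellin kernel1 (of_real t) =
      Gamma (complex_of_real t) * dirichlet (of_real t) + 1 / (2 * of_real t)"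
    unfolding Gamma_dirichlet by simp
  ultimately show "zeta_right (of_real t) = dirichlet (of_real t)"
    unfolding zeta_right_def by (simp add: distrib_left flip: mult.assoc)
qed (use assms dirichlet_holomorphic open_halfspace_Re_gt in auto)

lemma zeta_right_strip:
  assumes "-1 < Re s" "Re s < 0"
  shows "zeta_right s = zeta_factor s * dirichlet (1 - s)"
proof (rule holomorphic_eq_if_eq_on_reals[where
    f = zeta_right and g = "\<lambda>s. zeta_factor s * dirichlet (1 - s)" and z = s and a = "-1" and b = 0 and S = "{s. -1 < Re s \<and> Re s < 0}"])
  show "zeta_right holomorphic_on {s. -1 < Re s \<and> Re s < 0}"
    by (rule holomorphic_on_subset[OF zeta_right_holomorphic]) auto
  have "(dirichlet \<circ> (\<lambda>s. 1 - s)) holomorphic_on {s. -1 < Re s \<and> Re s < 0}"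
    by (rule holomorphic_on_compose_gen[OF _ dirichlet_holomorphic]) (auto intro!: holomorphic_intros)
  then show "(\<lambda>s. zeta_factor s * dirichlet (1 - s)) holomorphic_on {s. -1 < Re s \<and> Re s < 0}"
    by (intro holomorphic_intros holomorphic_on_subset[OF zeta_factor_holomorphic]) (auto simp: o_def)
  have strip: "{s. -1 < Re s \<and> Re s < 0} = {s. -1 < Re s} \<inter> {s. Re s < 0}" by auto
  show "open {s. -1 < Re s \<and> Re s < 0}" "connected {s. -1 < Re s \<and> Re s < 0}"
    unfolding strip
    by (intro open_Int open_halfspace_Re_gt open_halfspace_Re_lt,
        intro convex_connected convex_Int convex_halfspace_Re_gt convex_halfspace_Re_lt)
  fix t :: real assume t: "-1 < t" "t < 0"
  obtain I0 I1 where I: "has_mellin kernel0 t I0" "has_mellin kernel1 t I1"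
    using has_mellin_kernel0[of t] has_mellin_kernel1[of t] t by auto
  \<comment> \<open>Left of 0 the tail of \<open>1 / x - 1 / 2\<close> is subtracted instead. This
    adds the same terms in \<open>t\<close> but completes the kernels to the coth kernel.\<close>
  have "has_mellin (\<lambda>x. kernel0 x + kernel1 x + (-1) * (indicator {1<..} x / x) + (1/2) * indicator {1<..} x) t
      (I0 + I1 + (-1) * (- 1 / (t - 1)) + (1/2) * (- 1 / t))"
    using t by (intro has_mellin_add has_mellin_cmult has_mellin_shift[THEN iffD2]
        has_mellin_indicator_greaterThan_1 I) auto
  also have "?this \<longleftrightarrow> has_mellin (\<lambda>x. 1 / (exp x - 1) - 1 / x + 1 / 2) t
      (I0 + I1 + (-1) * (- 1 / (t - 1)) + (1/2) * (- 1 / t))"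
    by (rule has_mellin_cong) (auto simp: kernel0_def kernel1_def indicator_def)
  finally have I_eq: "(2 * pi) powr (t - 1) * (pi / cos (pi * t / 2)) * (\<Sum>n. 1 / real (Suc n) powr (1 - t)) =
      I0 + I1 + (-1) * (- 1 / (t - 1)) + (1/2) * (- 1 / t)"
    using has_mellin_coth_kernel[OF t] has_mellin_unique by blast
  define c where "c = cos (pi * t / 2)"
  define D where "D = (\<Sum>n. 1 / real (Suc n) powr (1 - t))"
  have "c > 0"
    unfolding c_def using t mult_strict_left_mono[of "-1" t pi] mult_pos_neg[of pi t]
    by (intro cos_gt_zero_pi) auto
  have D: "dirichlet (1 - of_real t) = of_real D"
    using dirichlet_of_real[of "1 - t"] t by (simp add: D_def)
  \<comment> \<open>Reflection and the double angle formula: the cosine \<open>c\<close> cancels the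
    one in the transform of the coth kernel and leaves the sine of
    \<open>zeta_factor\<close>.\<close>
  have rG: "rGamma (complex_of_real t) = Gamma (1 - of_real t) * of_real (2 * sin (pi * t / 2) * c / pi)"
  proof -
    have "1 - complex_of_real t \<notin> \<int>\<^sub>\<le>\<^sub>0"
      using t by (auto elim!: nonpos_Ints_cases simp: complex_eq_iff)
    then have "rGamma (complex_of_real t) = Gamma (1 - of_real t) * (sin (of_real pi * of_real t) / of_real pi)"
      unfolding rGamma_reflection_complex[symmetric] by (simp add: rGamma_inverse_Gamma Gamma_eq_zero_iff)
    also have "sin (of_real pi * of_real t) = complex_of_real (sin (pi * t))"
      by (metis of_real_mult sin_of_real)
    also have "sin (pi * t) = 2 * sin (pi * t / 2) * c"
      using sin_double[of "pi * t / 2"] by (simp add: c_def)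
    finally show ?thesis by simp
  qed
  have "rGamma (of_real t + 1) = rGamma (complex_of_real t) / of_real t"
    using rGamma_plus1[of "complex_of_real t"] t by (simp add: field_simps)
  then have "zeta_right (of_real t) = rGamma (of_real t) * of_real (I0 + I1 + (-1) * (- 1 / (t - 1)) + (1/2) * (- 1 / t))"
    unfolding zeta_right_def mellin_of_real[OF I(1)] mellin_of_real[OF I(2)]
    by (simp add: distrib_left right_diff_distrib)
  also have "\<dots> = Gamma (1 - of_real t) * of_real (2 * sin (pi * t / 2) * c / pi * ((2 * pi) powr (t - 1) * (pi / c) * D))"
    unfolding I_eq[symmetric] rG D_def c_def by simp
  also have "2 * sin (pi * t / 2) * c / pi * ((2 * pi) powr (t - 1) * (pi / c) * D) =
      (2 * pi) powr t / pi * sin (pi * t / 2) * D"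
    using \<open>c > 0\<close> by (simp add: powr_diff)
  also have "Gamma (1 - of_real t) * of_real ((2 * pi) powr t / pi * sin (pi * t / 2) * D) =
      zeta_factor (of_real t) * dirichlet (1 - of_real t)"
  proof -
    have "of_real (2 * pi) powr of_real t = complex_of_real ((2 * pi) powr t)"
      by (rule powr_of_real) auto
    moreover have "sin (of_real pi * of_real t / 2) = complex_of_real (sin (pi * t / 2))"
      by (metis of_real_divide of_real_mult of_real_numeral sin_of_real)
    ultimately show ?thesis
      unfolding zeta_factor_def D by simp
  qed
  finally show "zeta_right (of_real t) = zeta_factor (of_real t) * dirichlet (1 - of_real t)" .
qed (use assms in auto)

section \<open>Existence, uniqueness and symmetries of the continued zeta function\<close>

lemma zeta_unique:
  assumes "f holomorphic_on (- {1})" "\<forall>s. Re s > 1 \<longrightarrow> f s = (\<Sum>n. 1 / of_nat (Suc n) powr s)" "f 1 = 0"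
    and "g holomorphic_on (- {1})" "\<forall>s. Re s > 1 \<longrightarrow> g s = (\<Sum>n. 1 / of_nat (Suc n) powr s)" "g 1 = 0"
  shows "f = g"
proof
  fix s :: complex
  show "f s = g s"
  proof (cases "s = 1")
    case False
    show ?thesis
    proof (rule holomorphic_eq_if_eq_on_reals[where
    f = f and g = g and z = s and a = 2 and b = 3 and S = "-{1}"])
      show "connected (-{1 :: complex})"
        by (rule connected_punctured_universe) simp
      show "complex_of_real x \<in> - {1}" if "2 < x" "x < 3" for x
        using that by auto
    qed (use assms False in auto)
  qed (use assms in simp)
qed

text \<open>Gluing: \<open>zeta_right\<close> and the reflected Dirichlet series have open domains
  that cover the punctured plane and overlap in a strip where they agree. The three facts share one
  proof because each needs \<open>zeta\<close> identified with the glued function.\<close>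

lemma
  shows zeta_holomorphic: "zeta holomorphic_on (- {1})"
    and zeta_eq_dirichlet: "Re s > 1 \<Longrightarrow> zeta s = dirichlet s"
    and zeta_eq_left: "Re s < 0 \<Longrightarrow> zeta s = zeta_factor s * zeta (1 - s)"
proof -
  define P where "P = (\<lambda>f. f holomorphic_on (- {1}) \<and>
      (\<forall>s. Re s > 1 \<longrightarrow> f s = (\<Sum>n. 1 / of_nat (Suc n) powr s)) \<and> f (1 :: complex) = (0 :: complex))"
  define A where "A = {s. Re s > -1} - {1 :: complex}"
  define B where "B = {s. Re s < 0}"
  define f where "f = (\<lambda>s. if s \<in> A then zeta_right s else zeta_factor s * dirichlet (1 - s))"
  \<comment> \<open>At 1 the function \<open>f\<close> falls into its else branch; \<open>F\<close>
    resets that value to the convention.\<close>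
  define F where "F = (\<lambda>s. if s = 1 then 0 else f s)"
  have open_A: "open A"
    unfolding A_def by (intro open_Diff open_halfspace_Re_gt) auto
  have open_B: "open B"
    unfolding B_def by (rule open_halfspace_Re_lt)
  have "(dirichlet \<circ> (\<lambda>s. 1 - s)) holomorphic_on B"
    unfolding B_def
    by (rule holomorphic_on_compose_gen[OF _ dirichlet_holomorphic]) (auto intro!: holomorphic_intros)
  then have left: "(\<lambda>s. zeta_factor s * dirichlet (1 - s)) holomorphic_on B"
    unfolding B_def
    by (intro holomorphic_intros holomorphic_on_subset[OF zeta_factor_holomorphic]) (auto simp: o_def)
  have agree: "zeta_right s = zeta_factor s * dirichlet (1 - s)" if "s \<in> A" "s \<in> B" for s
    using that zeta_right_strip by (auto simp: A_def B_def)
  have "f holomorphic_on (A \<union> B)"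
    unfolding f_def using zeta_right_holomorphic left open_A open_B agree
    by (intro holomorphic_on_If_Un) (auto simp: A_def)
  also have "A \<union> B = - {1}"
    by (auto simp: A_def B_def)
  also have "f holomorphic_on (- {1}) \<longleftrightarrow> F holomorphic_on (- {1})"
    by (rule holomorphic_cong) (auto simp: F_def)
  finally have "P F"
    unfolding P_def
    by (auto simp: F_def f_def A_def zeta_right_eq_dirichlet dirichlet_def)
  moreover have "G = F" if "P G" for G
    using zeta_unique[of G F] that \<open>P F\<close> unfolding P_def by blast
  ultimately have "zeta = F"
    unfolding zeta_def P_def by (rule the_equality)
  show "zeta holomorphic_on (- {1})"
    using \<open>P F\<close> by (simp add: P_def \<open>zeta = F\<close>)
  have dir: "zeta s = dirichlet s" if "Re s > 1" for s
    using \<open>P F\<close> that by (simp add: P_def \<open>zeta = F\<close> dirichlet_def)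
  then show "Re s > 1 \<Longrightarrow> zeta s = dirichlet s" .
  assume s: "Re s < 0"
  then have "zeta s = zeta_factor s * dirichlet (1 - s)"
    using agree[of s] by (auto simp: \<open>zeta = F\<close> F_def f_def A_def B_def)
  then show "zeta s = zeta_factor s * zeta (1 - s)"
    using s dir[of "1 - s"] by simp
qed

text \<open>Continuation of \<open>zeta_eq_left\<close> to the half-plane left of 1. The point 0 is
  removed because \<open>1 - s\<close> would be the pole.\<close>

theorem zeta_functional_equation:
  assumes "Re s < 1" "s \<noteq> 0"
  shows "zeta s = zeta_factor s * zeta (1 - s)"
proof (rule holomorphic_eq_if_eq_on_reals[where
    f = zeta and g = "\<lambda>s. zeta_factor s * zeta (1 - s)" and z = s and a = "-2" and b = "-1" and S = "{s. Re s < 1} - {0}"])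
  show "zeta holomorphic_on {s. Re s < 1} - {0}"
    by (rule holomorphic_on_subset[OF zeta_holomorphic]) auto
  have "(zeta \<circ> (\<lambda>s. 1 - s)) holomorphic_on {s. Re s < 1} - {0}"
    by (rule holomorphic_on_compose_gen[OF _ zeta_holomorphic]) (auto intro!: holomorphic_intros)
  then show "(\<lambda>s. zeta_factor s * zeta (1 - s)) holomorphic_on {s. Re s < 1} - {0}"
    by (intro holomorphic_intros holomorphic_on_subset[OF zeta_factor_holomorphic]) (auto simp: o_def)
  show "open ({s. Re s < 1} - {0})"
    by (intro open_Diff open_halfspace_Re_lt) auto
  show "connected ({s. Re s < 1} - {0 :: complex})"
    by (intro connected_open_delete open_halfspace_Re_lt convex_connected convex_halfspace_Re_lt) auto
qed (use assms zeta_eq_left in auto)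

text \<open>Schwarz reflection: \<open>cnj \<circ> zeta \<circ> cnj\<close> is holomorphic and
  agrees with \<open>zeta\<close> on real arguments between 2 and 3, where the values are
  real.\<close>

lemma zeta_cnj:
  assumes "s \<noteq> 1"
  shows "zeta (cnj s) = cnj (zeta s)"
proof -
  have "(cnj \<circ> zeta \<circ> cnj) s = zeta s"
  proof (rule holomorphic_eq_if_eq_on_reals[where
    f = "cnj \<circ> zeta \<circ> cnj" and g = zeta and z = s and a = 2 and b = 3 and S = "-{1}"])
    show "cnj \<circ> zeta \<circ> cnj holomorphic_on - {1}"
      by (rule holomorphic_on_compose_cnj_cnj)
         (auto intro: holomorphic_on_subset[OF zeta_holomorphic] simp: complex_eq_iff)
    show "connected (-{1 :: complex})"
      by (rule connected_punctured_universe) simp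
    show "(cnj \<circ> zeta \<circ> cnj) (of_real x) = zeta (of_real x)" if "2 < x" "x < 3" for x
      using that by (simp add: zeta_eq_dirichlet dirichlet_of_real)
    show "complex_of_real x \<in> - {1}" if "2 < x" "x < 3" for x
      using that by auto
  qed (use zeta_holomorphic assms in auto)
  then show ?thesis
    by (metis comp_apply complex_cnj_cnj)
qed

section \<open>The critical line\<close>

text \<open>Doubling gives \<open>sin (2 * w) = cosh y\<close> and
  \<open>cos (2 * w) = - i * sinh y\<close>, so the cotangent is
  \<open>cosh y / (1 + i * sinh y)\<close>.\<close>

lemma cot_quarter_pi_add_imag:
  fixes y :: real
  defines "w \<equiv> of_real pi / 4 + \<i> * of_real (y / 2)"
  shows "sin w \<noteq> 0" and "Re (cos w / sin w) = 1 / cosh y"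
proof -
  have w2: "2 * w = of_real pi / 2 + \<i> * of_real y"
    by (simp add: w_def field_simps)
  have sin_iy: "sin (\<i> * complex_of_real y) = \<i> * of_real (sinh y)"
    by (simp add: complex_eq_iff Re_sin Im_sin cosh_def sinh_def)
  have cos_iy: "cos (\<i> * complex_of_real y) = of_real (cosh y)"
    by (simp add: complex_eq_iff Re_cos Im_cos cosh_def sinh_def)
  have pi_half: "sin (complex_of_real pi / 2) = 1" "cos (complex_of_real pi / 2) = 0"
    by (metis of_real_divide of_real_numeral sin_of_real cos_of_real sin_pi_half cos_pi_half of_real_1 of_real_0)+
  have sin_2w: "2 * sin w * cos w = of_real (cosh y)"
    unfolding sin_double[symmetric] w2 sin_add pi_half cos_iy by simp
  have cos_2w: "1 - 2 * (sin w)\<^sup>2 = - \<i> * of_real (sinh y)"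
    unfolding cos_double_sin[symmetric] w2 cos_add pi_half sin_iy by simp
  show nz: "sin w \<noteq> 0"
    using sin_2w cosh_real_pos[of y] by auto
  have "cos w / sin w = (2 * sin w * cos w) / (2 * (sin w)\<^sup>2)"
    using nz by (simp add: power2_eq_square)
  also have "2 * (sin w)\<^sup>2 = 1 + \<i> * of_real (sinh y)"
    using cos_2w by (simp add: algebra_simps)
  finally have "cos w / sin w = of_real (cosh y) / (1 + \<i> * of_real (sinh y))"
    by (simp only: sin_2w)
  then have "Re (cos w / sin w) = cosh y / (1 + (sinh y)\<^sup>2)"
    by (simp add: Re_divide)
  also have "1 + (sinh y)\<^sup>2 = (cosh y)\<^sup>2"
    by (simp add: cosh_square_eq)
  finally show "Re (cos w / sin w) = 1 / cosh y"
    by (simp add: power2_eq_square)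
qed

section \<open>Monotonicity and growth of the digamma function on the critical line\<close>

definition Re_Digamma_half :: "real \<Rightarrow> real" where
  "Re_Digamma_half \<rho> = Re (Digamma (1 / 2 + \<i> * of_real \<rho>))"

lemma Re_Digamma_half_sums:
  "(\<lambda>k. inverse (real (Suc k)) - (k + 1/2) / ((k + 1/2)\<^sup>2 + \<rho>\<^sup>2)) sums (Re_Digamma_half \<rho> + euler_mascheroni)"
proof -
  define z where "z = 1 / 2 + \<i> * complex_of_real \<rho>"
  have "z \<noteq> 0" by (auto simp: z_def complex_eq_iff)
  then have "(\<lambda>k. inverse (of_nat (Suc k)) - inverse (z + of_nat k)) sums (Digamma z + euler_mascheroni)"
    using summable_sums[OF summable_Digamma[of z]] by (simp add: Digamma_def del: of_nat_Suc)
  then have "(\<lambda>k. Re (inverse (of_nat (Suc k)) - inverse (z + of_nat k))) sums Re (Digamma z + euler_mascheroni)"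
    by (rule sums_Re)
  moreover have "Re (inverse (of_nat (Suc k)) - inverse (z + of_nat k)) =
      inverse (real (Suc k)) - (k + 1/2) / ((k + 1/2)\<^sup>2 + \<rho>\<^sup>2)" for k
  proof -
    have "inverse (of_nat (Suc k)) = complex_of_real (inverse (real (Suc k)))" by simp
    then have "Re (inverse (of_nat (Suc k)) :: complex) = inverse (real (Suc k))"
      by (simp only: Re_complex_of_real)
    then show ?thesis by (simp add: z_def add.commute del: of_nat_Suc)
  qed
  moreover have "Re (Digamma z + euler_mascheroni) = Re_Digamma_half \<rho> + euler_mascheroni"
    unfolding Re_Digamma_half_def z_def
    by (metis Re_complex_of_real of_real_euler_mascheroni plus_complex.sel(1))
  ultimately show ?thesis by simp
qed

lemma Re_Digamma_half_diff_sums: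
  "(\<lambda>k. (k + 1/2) / ((k + 1/2)\<^sup>2 + x\<^sup>2) - (k + 1/2) / ((k + 1/2)\<^sup>2 + y\<^sup>2)) sums
     (Re_Digamma_half y - Re_Digamma_half x)"
  using sums_diff[OF Re_Digamma_half_sums[of y] Re_Digamma_half_sums[of x]] by simp

text \<open>Every term of the series for the difference is positive.\<close>

lemma Re_Digamma_half_strict_mono:
  assumes "0 \<le> x" "x < y"
  shows "Re_Digamma_half x < Re_Digamma_half y"
proof -
  have "x\<^sup>2 < y\<^sup>2" using assms by (intro power_strict_mono) auto
  then have pos: "0 < (k + 1/2) / ((k + 1/2)\<^sup>2 + x\<^sup>2) - (k + 1/2) / ((k + 1/2)\<^sup>2 + y\<^sup>2)" for k :: nat
    by (intro diff_gt_0_iff_gt[THEN iffD2] divide_strict_left_mono mult_pos_pos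
        add_pos_nonneg[of "(real k + 1/2)\<^sup>2"] add_strict_left_mono) auto
  have "0 < (\<Sum>k. (k + 1/2) / ((k + 1/2)\<^sup>2 + x\<^sup>2) - (k + 1/2) / ((k + 1/2)\<^sup>2 + y\<^sup>2))"
    using Re_Digamma_half_diff_sums[of x y] pos by (intro suminf_pos) (auto simp: sums_iff)
  then show ?thesis
    using Re_Digamma_half_diff_sums[of x y] by (simp add: sums_iff)
qed

text \<open>Unboundedness, needed for a sign change. With \<open>a = k + 1/2\<close> at most
  \<open>N\<close>, a term is at least \<open>1 / a - a / (2 * a^2) = 1 / (2 * a)\<close>, and the
  first \<open>N\<close> terms dominate half a harmonic sum.\<close>

lemma Re_Digamma_half_lower: "harm N / 2 \<le> Re_Digamma_half (real N) - Re_Digamma_half 0"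
proof -
  let ?t = "\<lambda>k::nat. (k + 1/2) / ((k + 1/2)\<^sup>2 + 0\<^sup>2) - (k + 1/2) / ((k + 1/2)\<^sup>2 + (real N)\<^sup>2)"
  have "harm N / 2 = (\<Sum>k<N. 1 / (2 * real (Suc k)))"
    by (simp add: harm_altdef sum_divide_distrib inverse_eq_divide field_simps)
  also have "\<dots> \<le> (\<Sum>k<N. ?t k)"
  proof (rule sum_mono)
    fix k assume "k \<in> {..<N}"
    define a where "a = real k + 1/2"
    have a: "0 < a" "a \<le> real N" "a \<le> real (Suc k)"
      using \<open>k \<in> {..<N}\<close> by (auto simp: a_def)
    have sq: "a\<^sup>2 \<le> (real N)\<^sup>2" using a by (intro power_mono) auto
    have "1 / (2 * real (Suc k)) \<le> 1 / (2 * a)"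
      using a by (intro divide_left_mono) auto
    also have "1 / (2 * a) = 1 / a - a / (a\<^sup>2 + a\<^sup>2)"
      using a by (simp add: field_simps power2_eq_square)
    also have "\<dots> \<le> 1 / a - a / (a\<^sup>2 + (real N)\<^sup>2)"
      using a sq by (intro diff_left_mono divide_left_mono mult_pos_pos add_pos_nonneg add_left_mono) auto
    also have "1 / a = a / (a\<^sup>2 + 0\<^sup>2)"
      using a by (simp add: power2_eq_square)
    finally show "1 / (2 * real (Suc k)) \<le> ?t k" unfolding a_def .
  qed
  also have "\<dots> \<le> suminf ?t"
  proof (rule sum_le_suminf)
    show "summable ?t" using Re_Digamma_half_diff_sums[of 0 "real N"] by (simp add: sums_iff)
    show "?t k \<ge> 0" for k
      by (intro diff_ge_0_iff_ge[THEN iffD2] divide_left_mono mult_pos_pos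
          add_pos_nonneg[of "(real k + 1/2)\<^sup>2"] add_left_mono) auto
  qed auto
  also have "suminf ?t = Re_Digamma_half (real N) - Re_Digamma_half 0"
    using Re_Digamma_half_diff_sums[of 0 "real N"] by (simp add: sums_iff)
  finally show ?thesis .
qed

text \<open>
  The logarithmic derivative of \<^const>\<open>zeta_factor\<close> on the critical line; multiplied by
  \<open>2 * cosh (pi * \<rho>)\<close> it is the function whose root defines \<^const>\<open>rho_s\<close>.
\<close>
definition factor_log_deriv :: "real \<Rightarrow> real" where
  "factor_log_deriv \<rho> = ln (2 * pi) - Re_Digamma_half \<rho> + pi / (2 * cosh (pi * \<rho>))"

lemma factor_log_deriv_strict_antimono:
  assumes "0 \<le> x" "x < y"
  shows "factor_log_deriv y < factor_log_deriv x"
proof -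
  have "cosh (pi * x) < cosh (pi * y)"
    using assms by (subst cosh_real_nonneg_less_iff) auto
  then have "pi / (2 * cosh (pi * y)) \<le> pi / (2 * cosh (pi * x))"
    by (intro divide_left_mono) auto
  then show ?thesis
    using Re_Digamma_half_strict_mono[OF assms] by (simp add: factor_log_deriv_def)
qed

text \<open>The digamma value at 1/2 is \<open>- euler_mascheroni - 2 * ln 2\<close>, so every
  summand is positive.\<close>

lemma factor_log_deriv_0_pos: "factor_log_deriv 0 > 0"
proof -
  have "Re (Digamma (1/2 :: complex)) = Digamma (1/2 :: real)"
    using Polygamma_of_real[of "1/2" 0, where 'a = complex] by simp
  then have "Re_Digamma_half 0 = - euler_mascheroni - 2 * ln 2"
    by (simp add: Re_Digamma_half_def Digamma_one_half)
  moreover have "ln (2 * pi) > 0"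
    using pi_gt3 by (intro ln_gt_zero) simp
  moreover have "ln 2 > (0 :: real)" by simp
  moreover have "factor_log_deriv 0 = ln (2 * pi) - Re_Digamma_half 0 + pi / 2"
    by (simp add: factor_log_deriv_def)
  ultimately show ?thesis
    using euler_mascheroni_pos pi_gt_zero by linarith
qed

lemma continuous_factor_log_deriv: "continuous_on UNIV factor_log_deriv"
proof -
  have "1 / 2 + \<i> * complex_of_real \<rho> \<notin> \<int>\<^sub>\<le>\<^sub>0" for \<rho>
    by (auto elim!: nonpos_Ints_cases simp: complex_eq_iff)
  then have "isCont (\<lambda>\<rho>. Digamma (1 / 2 + \<i> * complex_of_real \<rho>)) \<rho>" for \<rho>
    by (intro continuous_intros)
  then have "continuous_on UNIV (\<lambda>\<rho>. Digamma (1 / 2 + \<i> * complex_of_real \<rho>))"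
    by (simp add: continuous_at_imp_continuous_on)
  then show ?thesis
    unfolding factor_log_deriv_def Re_Digamma_half_def by (intro continuous_intros) auto
qed

text \<open>Intermediate value theorem from 0 to an integer \<open>N\<close> whose harmonic number
  outweighs the remaining terms, the cosh term being at most \<open>pi / 2\<close>.\<close>

lemma factor_log_deriv_has_root: "\<exists>x>0. factor_log_deriv x = 0"
proof -
  have "\<forall>\<^sub>F N in sequentially. harm N > 2 * (ln (2 * pi) - Re_Digamma_half 0 + pi / 2)"
    using harm_at_top by (simp add: filterlim_at_top_dense)
  then obtain N where N: "harm N > 2 * (ln (2 * pi) - Re_Digamma_half 0 + pi / 2)"
    using eventually_happens trivial_limit_sequentially by blast
  have "pi / (2 * cosh (pi * real N)) \<le> pi / 2"
    using cosh_real_ge_1[of "pi * real N"] by (simp add: field_simps)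
  then have "factor_log_deriv (real N) \<le> 0"
    using N Re_Digamma_half_lower[of N] by (simp add: factor_log_deriv_def)
  then obtain x where "0 \<le> x" "factor_log_deriv x = 0"
    using IVT2'[of factor_log_deriv "real N" 0 0] factor_log_deriv_0_pos
      continuous_on_subset[OF continuous_factor_log_deriv] by auto
  then show ?thesis
    using factor_log_deriv_0_pos by (intro exI[of _ x]) (cases "x = 0", auto)
qed

text \<open>Existence and strict monotonicity give exactly one nonnegative root, so the description
  defining \<open>rho_s\<close> denotes it.\<close>

lemma factor_log_deriv_eq_0_iff:
  assumes "\<rho> \<ge> 0"
  shows "factor_log_deriv \<rho> = 0 \<longleftrightarrow> \<rho> = rho_s"
proof -
  obtain x where x: "x > 0" "factor_log_deriv x = 0"
    using factor_log_deriv_has_root by blast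
  have unique: "y = x" if "y \<ge> 0" "factor_log_deriv y = 0" for y
    using that x factor_log_deriv_strict_antimono[of x y] factor_log_deriv_strict_antimono[of y x]
    by (cases x y rule: linorder_cases) auto
  have "2 * ln (2 * pi) * cosh (pi * \<rho>) - 2 * Re (Digamma (1/2 + \<i> * of_real \<rho>)) * cosh (pi * \<rho>) + pi =
      2 * cosh (pi * \<rho>) * factor_log_deriv \<rho>" for \<rho>
    by (simp add: factor_log_deriv_def Re_Digamma_half_def field_simps)
  then have "rho_s = (THE \<rho>. \<rho> > 0 \<and> factor_log_deriv \<rho> = 0)"
    by (simp add: rho_s_def)
  also have "\<dots> = x"
    using x unique by (intro the_equality) auto
  finally show ?thesis
    using x unique assms by auto
qed

text \<open>Logarithmic differentiation; the sine contributes \<open>pi / 2\<close> times a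
  cotangent, evaluated with \<open>y = pi * \<rho>\<close>. Only the real part of \<open>L\<close>
  is computed.\<close>

lemma zeta_factor_has_derivative:
  fixes \<rho> :: real
  defines "s \<equiv> 1 / 2 + \<i> * of_real \<rho>"
  shows "\<exists>L. (zeta_factor has_field_derivative zeta_factor s * L) (at s) \<and> Re L = factor_log_deriv \<rho>"
proof -
  define w where "w = of_real pi * s / 2"
  have "w = of_real pi / 4 + \<i> * of_real (pi * \<rho> / 2)"
    by (simp add: w_def s_def field_simps)
  note w = cot_quarter_pi_add_imag[of "pi * \<rho>", folded this]
  define L where "L = of_real (ln (2 * pi)) - Digamma (1 - s) + of_real (pi / 2) * (cos w / sin w)"
  have s: "1 - s \<notin> \<int>\<^sub>\<le>\<^sub>0"
    by (auto elim!: nonpos_Ints_cases simp: complex_eq_iff s_def)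
  have Ln: "Ln (complex_of_real (2 * pi)) = of_real (ln (2 * pi))"
    by (rule Ln_of_real) simp
  define c where "c = complex_of_real (2 * pi)"
  have "c \<noteq> 0" by (simp add: c_def)
  have "((\<lambda>s. c powr s / of_real pi * Gamma (1 - s) * sin (of_real pi * s / 2)) has_field_derivative
      (Ln c * c powr s / of_real pi * Gamma (1 - s) - c powr s / of_real pi * (Gamma (1 - s) * Digamma (1 - s))) * sin w
      + c powr s / of_real pi * Gamma (1 - s) * (of_real pi / 2 * cos w)) (at s)"
    unfolding w_def using s \<open>c \<noteq> 0\<close>
    by (auto intro!: derivative_eq_intros simp: field_simps power2_eq_square)
  also have "(\<lambda>s. c powr s / of_real pi * Gamma (1 - s) * sin (of_real pi * s / 2)) = zeta_factor"
    by (simp add: zeta_factor_def[abs_def] c_def)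
  also have "(Ln c * c powr s / of_real pi * Gamma (1 - s) - c powr s / of_real pi * (Gamma (1 - s) * Digamma (1 - s))) * sin w
      + c powr s / of_real pi * Gamma (1 - s) * (of_real pi / 2 * cos w) = zeta_factor s * L"
    unfolding L_def zeta_factor_def w_def[symmetric] Ln[symmetric] c_def[symmetric]
    using w(1) by (simp add: field_simps)
  finally have "(zeta_factor has_field_derivative zeta_factor s * L) (at s)" .
  moreover have "Re (Digamma (1 - s)) = Re_Digamma_half \<rho>"
  proof -
    \<comment> \<open>The series contains \<open>\<rho>\<close> only through its square, so its sum
      is even.\<close>
    have "Re_Digamma_half (- \<rho>) = Re_Digamma_half \<rho>"
      using sums_unique2[OF Re_Digamma_half_sums[of "- \<rho>"]] Re_Digamma_half_sums[of \<rho>] by fastforce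
    moreover have "1 - s = 1 / 2 + \<i> * of_real (- \<rho>)"
      by (simp add: s_def field_simps)
    ultimately show ?thesis by (simp only: Re_Digamma_half_def)
  qed
  moreover have "Re L = ln (2 * pi) - Re (Digamma (1 - s)) + pi / 2 * Re (cos w / sin w)"
    unfolding L_def
    by (simp only: plus_complex.sel minus_complex.sel times_complex.sel Re_complex_of_real Im_complex_of_real)
  ultimately show ?thesis
    using w(2) by (auto simp: factor_log_deriv_def)
qed

text \<open>Duplication at \<open>(1 - s) / 2 = cnj (s / 2)\<close> expresses
  \<open>Gamma (1 - s)\<close> through \<open>cnj F * Gamma (1 - s / 2)\<close>, and reflection at
  \<open>s / 2\<close> removes the sine. The powers of 2 cancel; those of \<open>pi\<close> leave
  the unimodular factor.\<close>

lemma zeta_factor_mult_Gamma: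
  fixes \<rho> :: real
  defines "s \<equiv> 1 / 2 + \<i> * of_real \<rho>" and "F \<equiv> Gamma (1 / 4 + \<i> * of_real \<rho> / 2)"
  shows "zeta_factor s * F = cis (\<rho> * ln pi) * cnj F"
proof -
  have s2: "1 / 4 + \<i> * of_real \<rho> / 2 = s / 2"
    by (simp add: s_def)
  have cnj_s2: "cnj (s / 2) = (1 - s) / 2"
    by (simp add: s_def complex_eq_iff)
  have nz: "(1 - s) / 2 \<notin> \<int>\<^sub>\<le>\<^sub>0" "(1 - s) / 2 + 1 / 2 \<notin> \<int>\<^sub>\<le>\<^sub>0" "s / 2 \<notin> \<int>\<^sub>\<le>\<^sub>0"
    by (auto elim!: nonpos_Ints_cases simp: complex_eq_iff s_def)
  have dupl: "cnj F * Gamma (1 - s / 2) = exp (s * of_real (ln 2)) * of_real (sqrt pi) * Gamma (1 - s)"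
    using Gamma_legendre_duplication[OF nz(1,2)]
    by (simp add: F_def s2 cnj_Gamma cnj_s2[simplified] diff_divide_distrib)
  have refl: "sin (of_real pi * s / 2) * F * Gamma (1 - s / 2) = of_real pi"
  proof -
    have "rGamma (s / 2) * rGamma (1 - s / 2) = sin (of_real pi * s / 2) / of_real pi"
      using rGamma_reflection_complex[of "s / 2"] by simp
    moreover have "Gamma (1 - s / 2) \<noteq> 0" "F \<noteq> 0"
      using nz by (simp_all add: F_def s2 Gamma_eq_zero_iff diff_divide_distrib)
    ultimately show ?thesis
      by (simp add: rGamma_inverse_Gamma F_def s2 field_simps)
  qed
  have "Gamma (1 - s / 2) \<noteq> 0"
    using refl by auto
  have "of_real (2 * pi) powr s = exp (s * of_real (ln 2)) * exp (s * of_real (ln pi))"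
  proof -
    have "Ln (complex_of_real (2 * pi)) = of_real (ln 2 + ln pi)"
      using Ln_of_real[of "2 * pi"] by (simp only: ln_mult_pos pi_gt_zero mult_pos_pos zero_less_numeral)
    then show ?thesis
      unfolding powr_def by (simp only: of_real_add distrib_left exp_add) simp
  qed
  then have "zeta_factor s * F * Gamma (1 - s / 2) * of_real (sqrt pi) =
      exp (s * of_real (ln pi)) * (exp (s * of_real (ln 2)) * of_real (sqrt pi) * Gamma (1 - s)) *
      ((sin (of_real pi * s / 2) * F * Gamma (1 - s / 2)) / of_real pi)"
    by (simp add: zeta_factor_def)
  also have "\<dots> = exp (s * of_real (ln pi)) * cnj F * Gamma (1 - s / 2)"
    unfolding refl dupl[symmetric] by simp
  also have "exp (s * of_real (ln pi)) = of_real (sqrt pi) * cis (\<rho> * ln pi)"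
  proof -
    have "s * of_real (ln pi) = of_real (ln pi / 2) + \<i> * of_real (\<rho> * ln pi)"
      by (simp add: s_def field_simps)
    then have "exp (s * of_real (ln pi)) = of_real (exp (ln pi / 2)) * cis (\<rho> * ln pi)"
      by (simp only: exp_add exp_of_real cis_conv_exp)
    also have "exp (ln pi / 2) = sqrt pi"
      by (simp add: powr_half_sqrt[symmetric] powr_def)
    finally show ?thesis .
  qed
  finally show ?thesis
    using \<open>Gamma (1 - s / 2) \<noteq> 0\<close> by simp
qed

text \<open>
  Differentiating the functional equation gives \<open>Z + zeta_factor s * cnj Z = L * zeta s\<close>, where \<open>L\<close> is
  the logarithmic derivative of \<^const>\<open>zeta_factor\<close> at \<open>s\<close>. It is real where \<open>zeta s \<noteq> 0\<close>, since
  there it equals \<open>2 * Re (Z / zeta s)\<close>.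
\<close>
lemma deriv_zeta_critical_line:
  fixes \<rho> :: real
  defines "s \<equiv> 1 / 2 + \<i> * of_real \<rho>"
  defines "Z \<equiv> deriv zeta s"
  shows "Z = - (zeta_factor s * cnj Z) \<longleftrightarrow> zeta s = 0 \<or> factor_log_deriv \<rho> = 0"
proof -
  have s: "Re s = 1/2" "cnj s = 1 - s" "s \<noteq> 1" "s \<noteq> 0" "1 - s \<noteq> 1" "cnj s \<noteq> 1"
    by (auto simp: s_def complex_eq_iff)
  have deriv: "(zeta has_field_derivative deriv zeta z) (at z)" if "z \<noteq> 1" for z
    using that by (intro holomorphic_derivI[OF zeta_holomorphic]) auto
  \<comment> \<open>Conjugation symmetry yields the derivative at
    \<open>1 - s = cnj s\<close>.\<close>
  have "(cnj \<circ> zeta \<circ> cnj has_field_derivative cnj Z) (at (cnj s))"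
    using has_field_derivative_cnj_cnj[of zeta Z "cnj s"] deriv[of s] s by (simp add: Z_def)
  moreover have "\<forall>\<^sub>F z in nhds (cnj s). (cnj \<circ> zeta \<circ> cnj) z = zeta z"
    using t1_space_nhds[OF s(6)]
    by eventually_elim (simp add: zeta_cnj)
  ultimately have "(zeta has_field_derivative cnj Z) (at (1 - s))"
    using DERIV_cong_ev[OF refl _ refl] s(2) by metis
  obtain L where L: "(zeta_factor has_field_derivative zeta_factor s * L) (at s)" "Re L = factor_log_deriv \<rho>"
    unfolding s_def using zeta_factor_has_derivative by blast
  have "((\<lambda>z. zeta_factor z * zeta (1 - z)) has_field_derivative
      zeta_factor s * L * zeta (1 - s) + zeta_factor s * - cnj Z) (at s)"
    using \<open>(zeta has_field_derivative cnj Z) (at (1 - s))\<close> L(1)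
    by (auto intro!: derivative_eq_intros DERIV_chain2[of zeta])
  moreover have "\<forall>\<^sub>F z in nhds s. zeta_factor z * zeta (1 - z) = zeta z"
  proof (rule eventually_nhds_in_open[THEN eventually_mono])
    show "open ({z. Re z < 1} - {0})"
      by (intro open_Diff open_halfspace_Re_lt) auto
  qed (use s zeta_functional_equation in auto)
  ultimately have "(zeta has_field_derivative zeta_factor s * L * zeta (1 - s) + zeta_factor s * - cnj Z) (at s)"
    using DERIV_cong_ev[OF refl _ refl] by metis
  then have "Z = zeta_factor s * L * zeta (1 - s) + zeta_factor s * - cnj Z"
    unfolding Z_def by (rule DERIV_imp_deriv)
  moreover have fe: "zeta s = zeta_factor s * zeta (1 - s)"
    using s by (intro zeta_functional_equation) auto
  ultimately have Z: "Z + zeta_factor s * cnj Z = L * zeta s"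
    by (simp add: algebra_simps)
  have cnj_zeta: "zeta (1 - s) = cnj (zeta s)"
    using zeta_cnj[OF s(3)] s(2) by simp
  have "L = of_real (factor_log_deriv \<rho>)" if "zeta s \<noteq> 0"
  proof -
    \<comment> \<open>On the critical line the functional equation relates \<open>zeta s\<close> to
      its own conjugate; this makes \<open>L\<close> a number plus its conjugate.\<close>
    have "zeta_factor s = zeta s / cnj (zeta s)"
      using that fe unfolding cnj_zeta by (intro eq_divide_imp) auto
    then have "L * zeta s = Z + zeta s / cnj (zeta s) * cnj Z"
      using Z by simp
    then have "L = (Z + zeta s / cnj (zeta s) * cnj Z) / zeta s"
      using that by (intro eq_divide_imp) auto
    also have "\<dots> = Z / zeta s + cnj (Z / zeta s)"
      using that by (simp add: add_divide_distrib)
    finally have "L = Z / zeta s + cnj (Z / zeta s)" .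
    then have "Im L = Im (Z / zeta s + cnj (Z / zeta s))" by (rule arg_cong)
    also have "\<dots> = 0" by (simp only: plus_complex.sel cnj.sel)
    finally have "Im L = 0" .
    then show ?thesis using L(2) by (simp add: complex_eq_iff)
  qed
  then show ?thesis
    using Z by (cases "zeta s = 0") (auto simp: eq_neg_iff_add_eq_0)
qed

section \<open>The trigonometric equations as one complex equation\<close>

text \<open>The numerators are the imaginary and real parts of \<open>- (F * Z)^2\<close>.
  Multiplying the complex equation by the nonzero \<open>F * Z\<close> turns its left side into
  \<open>cis \<theta>\<close> times the common denominator.\<close>

lemma sin_cos_eq_iff_cis:
  fixes F Z :: complex
  assumes "F \<noteq> 0" "Z \<noteq> 0"
  shows "sin \<theta> = 2 * (Im F * Re Z + Re F * Im Z) * (Im F * Im Z - Re F * Re Z)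
           / (((Re Z)\<^sup>2 + (Im Z)\<^sup>2) * (cmod F)\<^sup>2) \<and>
         cos \<theta> = (4 * Im F * Re F * Im Z * Re Z + ((Im Z)\<^sup>2 - (Re Z)\<^sup>2) * (- (Im F)\<^sup>2 + (Re F)\<^sup>2))
           / (((Re Z)\<^sup>2 + (Im Z)\<^sup>2) * (cmod F)\<^sup>2)
     \<longleftrightarrow> cis \<theta> * cnj F * cnj Z = - (F * Z)"
proof -
  define r where "r = ((Re Z)\<^sup>2 + (Im Z)\<^sup>2) * (cmod F)\<^sup>2"
  have r: "complex_of_real r = F * Z * (cnj F * cnj Z)"
    using complex_norm_square[of F] complex_norm_square[of Z]
    by (simp add: r_def flip: cmod_power2)
  have "cis \<theta> * cnj F * cnj Z = - (F * Z) \<longleftrightarrow> (F * Z) * (cis \<theta> * cnj F * cnj Z) = (F * Z) * - (F * Z)"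
    using assms unfolding mult_cancel_left by simp
  also have "\<dots> \<longleftrightarrow> cis \<theta> * (F * Z * (cnj F * cnj Z)) = - (F * Z)\<^sup>2"
    by (simp add: power2_eq_square mult_ac)
  also have "\<dots> \<longleftrightarrow> cis \<theta> * of_real r = - (F * Z)\<^sup>2"
    by (simp only: r)
  also have "\<dots> \<longleftrightarrow> cis \<theta> = - (F * Z)\<^sup>2 / of_real r"
    using assms by (simp add: r field_simps)
  also have "\<dots> \<longleftrightarrow> cos \<theta> = Re (- (F * Z)\<^sup>2) / r \<and> sin \<theta> = Im (- (F * Z)\<^sup>2) / r"
    by (simp only: complex_eq_iff Re_divide_of_real Im_divide_of_real cis.sel)
  also have "Re (- (F * Z)\<^sup>2) = 4 * Im F * Re F * Im Z * Re Z + ((Im Z)\<^sup>2 - (Re Z)\<^sup>2) * (- (Im F)\<^sup>2 + (Re F)\<^sup>2)"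
    by (simp add: power2_eq_square algebra_simps)
  also have "Im (- (F * Z)\<^sup>2) = 2 * (Im F * Re Z + Re F * Im Z) * (Im F * Im Z - Re F * Re Z)"
    by (simp add: power2_eq_square algebra_simps)
  finally show ?thesis unfolding r_def by blast
qed

theorem mainTheorem6:
  fixes \<rho> :: real
  assumes "\<rho> \<ge> 0"
    and "deriv zeta (1/2 + \<i> * of_real \<rho>) \<noteq> 0"
  shows
    "let \<zeta>R = Re (deriv zeta (1/2 + \<i> * of_real \<rho>));
         \<zeta>I = Im (deriv zeta (1/2 + \<i> * of_real \<rho>));
         F = Gamma (1/4 + \<i> * of_real \<rho> / 2 :: complex);
         FR = Re F;
         FI = Im F
     in (sin (\<rho> * ln pi) =
           2 * (FI * \<zeta>R + FR * \<zeta>I) * (FI * \<zeta>I - FR * \<zeta>R)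
             / ((\<zeta>R\<^sup>2 + \<zeta>I\<^sup>2) * (cmod F)\<^sup>2) \<and>
         cos (\<rho> * ln pi) =
           (4 * FI * FR * \<zeta>I * \<zeta>R + (\<zeta>I\<^sup>2 - \<zeta>R\<^sup>2) * (- FI\<^sup>2 + FR\<^sup>2))
             / ((\<zeta>R\<^sup>2 + \<zeta>I\<^sup>2) * (cmod F)\<^sup>2))
        \<longleftrightarrow> (zeta (1/2 + \<i> * of_real \<rho>) = 0 \<or> \<rho> = rho_s)"
proof -
  define s where "s = 1 / 2 + \<i> * complex_of_real \<rho>"
  define F where "F = Gamma (1 / 4 + \<i> * complex_of_real \<rho> / 2)"
  define Z where "Z = deriv zeta s"
  have "F \<noteq> 0"
    unfolding F_def Gamma_eq_zero_iff by (auto elim!: nonpos_Ints_cases simp: complex_eq_iff)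
  have "Z \<noteq> 0" using assms(2) by (simp add: Z_def s_def)
  \<comment> \<open>Trading the unimodular factor for \<open>zeta_factor s\<close> exposes
    \<open>F\<close> on both sides, where it cancels.\<close>
  have "cis (\<rho> * ln pi) * cnj F * cnj Z = F * (zeta_factor s * cnj Z)"
    using zeta_factor_mult_Gamma[of \<rho>] unfolding s_def[symmetric] F_def[symmetric]
    by (metis mult.assoc mult.commute)
  then have "cis (\<rho> * ln pi) * cnj F * cnj Z = - (F * Z) \<longleftrightarrow> F * (zeta_factor s * cnj Z) = F * - Z"
    by (simp only: mult_minus_right)
  also have "\<dots> \<longleftrightarrow> Z = - (zeta_factor s * cnj Z)"
    unfolding mult_cancel_left using \<open>F \<noteq> 0\<close> by (metis minus_minus)
  also have "\<dots> \<longleftrightarrow> zeta s = 0 \<or> \<rho> = rho_s"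
    using deriv_zeta_critical_line[of \<rho>] factor_log_deriv_eq_0_iff[OF assms(1)]
    unfolding s_def Z_def by simp
  finally show ?thesis
    using sin_cos_eq_iff_cis[OF \<open>F \<noteq> 0\<close> \<open>Z \<noteq> 0\<close>, of "\<rho> * ln pi"]
    unfolding Let_def Z_def[symmetric] s_def[symmetric] F_def[symmetric] by simp
qed

end
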